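(* Let $M$ be a symmetric local pseudo MV-algebra from $\mathcal M$ and let $I=\mathrm{Rad}_n(M)$. Let $\mathbb H$ be a subgroup of $\mathbb R$ with $1\in\mathbb H$ such that $M/I\cong\Gamma(\mathbb H,1)$, let $G$ be an $\ell$-group such that $\langle I\rangle\cong\Gamma(\mathbb Z\overrightarrow{\times}G,(1,0))$, and let $N=\Gamma(\mathbb H\overrightarrow{\times}G,(1,0))$. The following statements are equivalent: (i) $M\cong N$. (ii) The (weak) free product $M/I\sqcup_w\langle I\rangle$ in the variety of symmetric pseudo MV-algebras from $\mathcal M$ is isomorphic to $M$.
   Context: A pseudo MV-algebra is an algebra $(M;\oplus,{}^-,{}^\sim,0,1)$ of type $(2,1,1,0,0)$ such that, with $y\odot x:=(x^-\oplus y^-)^\sim$, for all $x,y,z\in M$: (A1) $x\oplus(y\oplus z)=(x\oplus y)\oplus z$; (A2) $x\oplus 0=0\oplus x=x$; (A3) $x\oplus 1=1\oplus x=1$; (A4) $1^\sim=0=1^-$; (A5) $(x^-\oplus y^-)^\sim=(x^\sim\oplus y^\sim)^-$; (A6) $x\oplus(x^\sim\odot y)=y\oplus(y^\sim\odot x)=(x\odot y^-)\oplus y=(y\odot x^-)\oplus x$; (A7) $x\odot(x^-\oplus y)=(x\oplus y^\sim)\odot y$; (A8) $(x^-)^\sim=x$ ($\odot$ binds stronger than $\oplus$). It is a distributive lattice, with $x\vee y$ given by (A6) and $x\wedge y$ by (A7). $M$ is symmetric if $x^-=x^\sim$ for all $x$. An ideal of $M$ is a nonempty down-closed subset closed under $\oplus$;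 it is maximal if it is $\neq M$ and maximal among ideals $\ne M$, and normal if $x\oplus I=I\oplus x$ for all $x\in M$. For a normal ideal $I$, $M/I$ is the quotient pseudo MV-algebra with classes $x/I=\{y\in M:x\odot y^-\oplus y\odot x^-\in I\}$. $M$ is local if it has a unique maximal ideal and this ideal is normal. $\mathcal M$ is the class (a variety) of pseudo MV-algebras $M$ such that every maximal ideal of $M$ is normal, or $M$ is trivial. $\mathrm{Rad}_n(M)$ is the intersection of all ideals of $M$ that are both maximal and normal. $\langle I\rangle$ is the subalgebra of $M$ generated by $I$; for symmetric $M$, $\langle I\rangle=I\cup I^-$ with $I^-=\{x^-:x\in I\}$. For $M$ as in the claim, such $\mathbb H$ and $G$ always exist. $\ell$-groups are lattice-ordered groups, written additively and not assumed Abelian; a unital $\ell$-group $(G,u)$ is an $\ell$-group with a strong unit $u\ge0$, i.e. $G=\bigcup_n[-nu,nu]$. $\Gamma(G,u)$ is the pseudo MV-algebra on $\{g\in G:0\le g\le u\}$ with $x\oplus y=(x+y)\wedge u$, $x^-=u-x$, $x^\sim=-x+u$, $x\odot y=(x-u+y)\vee 0$ and constants $0,u$. Every pseudo MV-algebra $A$ is $\Gamma(W,w)$, up to isomorphism, for a unital $\ell$-group $(W,w)$ unique up to isomorphism. For a linearly ordered group $H$ and an $\ell$-group $G$, $H\overrightarrow{\times}G$ is $H\times G$ with the lexicographic order: $(h,g)\le(h_1,g_1)$ iff $h<h_1$, or $h=h_1$ and $g\le g_1$. The weak free product $M/I\sqcup_w\langle I\rangle$ in the variety of symmetric pseudo MV-algebras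 from $\mathcal M$ is an algebra $P$ of this variety together with injective homomorphisms $\phi_1:M/I\to P$ and $\phi_2:\langle I\rangle\to P$ such that: (i* ) $\phi_1(M/I)\cup\phi_2(\langle I\rangle)$ generates $P$; (ii* ) whenever $A=\Gamma(W,w)$ is a symmetric pseudo MV-algebra from $\mathcal M$ and $\kappa_1:M/I\to A$, $\kappa_2:\langle I\rangle\to A$ are homomorphisms with $\kappa_1(a)+\kappa_2(b)=\kappa_2(b)+\kappa_1(a)$ (sums in $W$) for all $a\in M/I$, $b\in\langle I\rangle$, there is a unique homomorphism $\psi:P\to A$ with $\psi\circ\phi_1=\kappa_1$ and $\psi\circ\phi_2=\kappa_2$.
   Formalization: The weak free product is also required to have commuting φ₁(a)+φ₂(b)=φ₂(b)+φ₁(a) in the group of P (without this, (ii) does not imply (i)); in (ii* ) the groups W range over an arbitrary infinite universe of size at least |M|. *)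

theory Defs
  imports Complex_Main "HOL-Algebra.Lattice" "HOL-Algebra.Group"
begin

section \<open>Pseudo MV-algebras\<close>

text \<open>\<open>lneg\<close> and \<open>rneg\<close> are the two negations, written \<open>x\<^sup>-\<close> and \<open>x\<^sup>~\<close> on paper.\<close>

record 'a pmv = "'a partial_object" +
  oplus :: "'a \<Rightarrow> 'a \<Rightarrow> 'a" (infixl \<open>\<oplus>\<index>\<close> 65)
  lneg :: "'a \<Rightarrow> 'a"
  rneg :: "'a \<Rightarrow> 'a"
  pmv_zero :: 'a
  pmv_one :: 'a

definition otimes :: "'a pmv \<Rightarrow> 'a \<Rightarrow> 'a \<Rightarrow> 'a" (infixl \<open>\<odot>\<index>\<close> 70)
  where "y \<odot>\<^bsub>M\<^esub> x = rneg M (lneg M x \<oplus>\<^bsub>M\<^esub> lneg M y)"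

locale pseudo_MV =
  fixes M :: "'a pmv" (structure)
  assumes oplus_closed: "\<lbrakk>x \<in> carrier M; y \<in> carrier M\<rbrakk> \<Longrightarrow> x \<oplus> y \<in> carrier M"
    and lneg_closed: "x \<in> carrier M \<Longrightarrow> lneg M x \<in> carrier M"
    and rneg_closed: "x \<in> carrier M \<Longrightarrow> rneg M x \<in> carrier M"
    and zero_closed: "pmv_zero M \<in> carrier M"
    and unit_closed: "pmv_one M \<in> carrier M"
    and A1: "\<lbrakk>x \<in> carrier M; y \<in> carrier M; z \<in> carrier M\<rbrakk> \<Longrightarrow> x \<oplus> (y \<oplus> z) = (x \<oplus> y) \<oplus> z"
    and A2: "x \<in> carrier M \<Longrightarrow> x \<oplus> pmv_zero M = x" "x \<in> carrier M \<Longrightarrow> pmv_zero M \<oplus> x = x"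
    and A3: "x \<in> carrier M \<Longrightarrow> x \<oplus> pmv_one M = pmv_one M" "x \<in> carrier M \<Longrightarrow> pmv_one M \<oplus> x = pmv_one M"
    and A4: "rneg M (pmv_one M) = pmv_zero M" "lneg M (pmv_one M) = pmv_zero M"
    and A5: "\<lbrakk>x \<in> carrier M; y \<in> carrier M\<rbrakk> \<Longrightarrow> rneg M (lneg M x \<oplus> lneg M y) = lneg M (rneg M x \<oplus> rneg M y)"
    and A6: "\<lbrakk>x \<in> carrier M; y \<in> carrier M\<rbrakk> \<Longrightarrow> x \<oplus> (rneg M x \<odot> y) = y \<oplus> (rneg M y \<odot> x)"
            "\<lbrakk>x \<in> carrier M; y \<in> carrier M\<rbrakk> \<Longrightarrow> y \<oplus> (rneg M y \<odot> x) = (x \<odot> lneg M y) \<oplus> y"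
            "\<lbrakk>x \<in> carrier M; y \<in> carrier M\<rbrakk> \<Longrightarrow> (x \<odot> lneg M y) \<oplus> y = (y \<odot> lneg M x) \<oplus> x"
    and A7: "\<lbrakk>x \<in> carrier M; y \<in> carrier M\<rbrakk> \<Longrightarrow> x \<odot> (lneg M x \<oplus> y) = (x \<oplus> rneg M y) \<odot> y"
    and A8: "x \<in> carrier M \<Longrightarrow> rneg M (lneg M x) = x"

definition pmv_join :: "'a pmv \<Rightarrow> 'a \<Rightarrow> 'a \<Rightarrow> 'a"
  where "pmv_join M x y = x \<oplus>\<^bsub>M\<^esub> (rneg M x \<odot>\<^bsub>M\<^esub> y)"

definition pmv_le :: "'a pmv \<Rightarrow> 'a \<Rightarrow> 'a \<Rightarrow> bool"
  where "pmv_le M x y \<longleftrightarrow> pmv_join M x y = y"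

definition pmv_symmetric :: "'a pmv \<Rightarrow> bool"
  where "pmv_symmetric M \<longleftrightarrow> (\<forall>x\<in>carrier M. lneg M x = rneg M x)"

definition pmv_hom :: "'a pmv \<Rightarrow> 'b pmv \<Rightarrow> ('a \<Rightarrow> 'b) set"
  where "pmv_hom A B = {f \<in> carrier A \<rightarrow> carrier B.
    (\<forall>x\<in>carrier A. \<forall>y\<in>carrier A. f (x \<oplus>\<^bsub>A\<^esub> y) = f x \<oplus>\<^bsub>B\<^esub> f y) \<and>
    (\<forall>x\<in>carrier A. f (lneg A x) = lneg B (f x)) \<and>
    (\<forall>x\<in>carrier A. f (rneg A x) = rneg B (f x)) \<and>
    f (pmv_zero A) = pmv_zero B \<and> f (pmv_one A) = pmv_one B}"

definition pmv_iso :: "'a pmv \<Rightarrow> 'b pmv \<Rightarrow> ('a \<Rightarrow> 'b) set"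
  where "pmv_iso A B = {f \<in> pmv_hom A B. bij_betw f (carrier A) (carrier B)}"

definition pmv_isomorphic :: "'a pmv \<Rightarrow> 'b pmv \<Rightarrow> bool" (infix \<open>\<cong>\<^sub>M\<close> 50)
  where "A \<cong>\<^sub>M B \<longleftrightarrow> pmv_iso A B \<noteq> {}"


section \<open>Ideals, quotients and subalgebras\<close>

definition pmv_ideal :: "'a pmv \<Rightarrow> 'a set \<Rightarrow> bool"
  where "pmv_ideal M I \<longleftrightarrow> I \<subseteq> carrier M \<and> I \<noteq> {} \<and>
    (\<forall>x\<in>carrier M. \<forall>y\<in>I. pmv_le M x y \<longrightarrow> x \<in> I) \<and>
    (\<forall>x\<in>I. \<forall>y\<in>I. x \<oplus>\<^bsub>M\<^esub> y \<in> I)"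

definition pmv_maximal_ideal :: "'a pmv \<Rightarrow> 'a set \<Rightarrow> bool"
  where "pmv_maximal_ideal M I \<longleftrightarrow> pmv_ideal M I \<and> I \<noteq> carrier M \<and>
    (\<forall>J. pmv_ideal M J \<longrightarrow> J \<noteq> carrier M \<longrightarrow> I \<subseteq> J \<longrightarrow> J = I)"

definition pmv_normal_ideal :: "'a pmv \<Rightarrow> 'a set \<Rightarrow> bool"
  where "pmv_normal_ideal M I \<longleftrightarrow> pmv_ideal M I \<and>
    (\<forall>x\<in>carrier M. (\<lambda>i. x \<oplus>\<^bsub>M\<^esub> i) ` I = (\<lambda>i. i \<oplus>\<^bsub>M\<^esub> x) ` I)"

definition pmv_local :: "'a pmv \<Rightarrow> bool"
  where "pmv_local M \<longleftrightarrow> (\<exists>!I. pmv_maximal_ideal M I) \<and>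
    (\<forall>I. pmv_maximal_ideal M I \<longrightarrow> pmv_normal_ideal M I)"

definition in_class_M :: "'a pmv \<Rightarrow> bool"
  where "in_class_M M \<longleftrightarrow> pseudo_MV M \<and>
    ((\<forall>I. pmv_maximal_ideal M I \<longrightarrow> pmv_normal_ideal M I) \<or> carrier M = {pmv_zero M})"

definition Rad_n :: "'a pmv \<Rightarrow> 'a set"
  where "Rad_n M = {x \<in> carrier M. \<forall>I. pmv_maximal_ideal M I \<and> pmv_normal_ideal M I \<longrightarrow> x \<in> I}"

definition pmv_class :: "'a pmv \<Rightarrow> 'a set \<Rightarrow> 'a \<Rightarrow> 'a set"
  where "pmv_class M I x = {y \<in> carrier M.
    x \<odot>\<^bsub>M\<^esub> lneg M y \<oplus>\<^bsub>M\<^esub> y \<odot>\<^bsub>M\<^esub> lneg M x \<in> I}"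

text \<open>For a normal ideal \<open>I\<close> the classes form a congruence partition, so each union below
  is the class of the result computed on arbitrary representatives.\<close>

definition pmv_quotient :: "'a pmv \<Rightarrow> 'a set \<Rightarrow> 'a set pmv"
  where "pmv_quotient M I = \<lparr>
    carrier = pmv_class M I ` carrier M,
    oplus = (\<lambda>X Y. \<Union>x\<in>X. \<Union>y\<in>Y. pmv_class M I (x \<oplus>\<^bsub>M\<^esub> y)),
    lneg = (\<lambda>X. \<Union>x\<in>X. pmv_class M I (lneg M x)),
    rneg = (\<lambda>X. \<Union>x\<in>X. pmv_class M I (rneg M x)),
    pmv_zero = pmv_class M I (pmv_zero M),
    pmv_one = pmv_class M I (pmv_one M)\<rparr>"

definition pmv_subuniverse :: "'a pmv \<Rightarrow> 'a set \<Rightarrow> bool"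
  where "pmv_subuniverse M S \<longleftrightarrow> S \<subseteq> carrier M \<and> pmv_zero M \<in> S \<and> pmv_one M \<in> S \<and>
    (\<forall>x\<in>S. \<forall>y\<in>S. x \<oplus>\<^bsub>M\<^esub> y \<in> S) \<and>
    (\<forall>x\<in>S. lneg M x \<in> S) \<and> (\<forall>x\<in>S. rneg M x \<in> S)"

definition pmv_span :: "'a pmv \<Rightarrow> 'a set \<Rightarrow> 'a set"
  where "pmv_span M X = \<Inter>{S. pmv_subuniverse M S \<and> X \<subseteq> S}"

definition generated_subalgebra :: "'a pmv \<Rightarrow> 'a set \<Rightarrow> 'a pmv"
  where "generated_subalgebra M X = M\<lparr>carrier := pmv_span M X\<rparr>"


section \<open>Lattice-ordered groups and the functor \<open>\<Gamma>\<close>\<close>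

text \<open>The group operation, although written additively on paper, is the (multiplicative)
  monoid operation \<open>\<otimes>\<close> of \<open>HOL-Algebra\<close>; accordingly \<open>-x\<close> is \<open>inv x\<close> and \<open>0\<close> is \<open>\<one>\<close>.\<close>

record 'a ordered_group = "'a monoid" +
  grp_le :: "'a \<Rightarrow> 'a \<Rightarrow> bool"

definition grp_order :: "'a ordered_group \<Rightarrow> 'a gorder"
  where "grp_order G = \<lparr>carrier = carrier G, eq = (=), le = grp_le G\<rparr>"

locale l_group = group G for G :: "'a ordered_group" (structure) +
  assumes lattice_order: "Lattice.lattice (grp_order G)"
    and le_mult_left:
      "\<lbrakk>a \<in> carrier G; b \<in> carrier G; c \<in> carrier G; grp_le G a b\<rbrakk> \<Longrightarrow> grp_le G (c \<otimes> a) (c \<otimes> b)"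
    and le_mult_right:
      "\<lbrakk>a \<in> carrier G; b \<in> carrier G; c \<in> carrier G; grp_le G a b\<rbrakk> \<Longrightarrow> grp_le G (a \<otimes> c) (b \<otimes> c)"

definition unital_l_group :: "'a ordered_group \<Rightarrow> 'a \<Rightarrow> bool"
  where "unital_l_group G u \<longleftrightarrow> l_group G \<and> u \<in> carrier G \<and> grp_le G \<one>\<^bsub>G\<^esub> u \<and>
    (\<forall>g\<in>carrier G. \<exists>n::nat.
       grp_le G (inv\<^bsub>G\<^esub> (u [^]\<^bsub>G\<^esub> n)) g \<and> grp_le G g (u [^]\<^bsub>G\<^esub> n))"

definition Gamma :: "'a ordered_group \<Rightarrow> 'a \<Rightarrow> 'a pmv"
  where "Gamma G u = \<lparr>
    carrier = {g \<in> carrier G. grp_le G \<one>\<^bsub>G\<^esub> g \<and> grp_le G g u},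
    oplus = (\<lambda>x y. (x \<otimes>\<^bsub>G\<^esub> y) \<sqinter>\<^bsub>grp_order G\<^esub> u),
    lneg = (\<lambda>x. u \<otimes>\<^bsub>G\<^esub> inv\<^bsub>G\<^esub> x),
    rneg = (\<lambda>x. inv\<^bsub>G\<^esub> x \<otimes>\<^bsub>G\<^esub> u),
    pmv_zero = \<one>\<^bsub>G\<^esub>,
    pmv_one = u\<rparr>"

definition additive_group :: "'a::{plus,zero,ord} set \<Rightarrow> 'a ordered_group"
  where "additive_group S = \<lparr>carrier = S, mult = (+), one = 0, grp_le = (\<le>)\<rparr>"

definition lex_product :: "'a ordered_group \<Rightarrow> 'b ordered_group \<Rightarrow> ('a \<times> 'b) ordered_group"
    (infixr \<open>\<times>\<^sub>l\<^sub>e\<^sub>x\<close> 80)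
  where "H \<times>\<^sub>l\<^sub>e\<^sub>x G = \<lparr>
    carrier = carrier H \<times> carrier G,
    mult = (\<lambda>(h, g) (h', g'). (h \<otimes>\<^bsub>H\<^esub> h', g \<otimes>\<^bsub>G\<^esub> g')),
    one = (\<one>\<^bsub>H\<^esub>, \<one>\<^bsub>G\<^esub>),
    grp_le = (\<lambda>(h, g) (h', g'). grp_le H h h' \<and> h \<noteq> h' \<or> h = h' \<and> grp_le G g g')\<rparr>"


section \<open>Weak free products\<close>

definition commuting_sums ::
    "'w ordered_group \<Rightarrow> 'a set \<Rightarrow> 'b set \<Rightarrow> ('a \<Rightarrow> 'w) \<Rightarrow> ('b \<Rightarrow> 'w) \<Rightarrow> bool"
  where "commuting_sums W A B \<kappa>\<^sub>1 \<kappa>\<^sub>2 \<longleftrightarrow>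
    (\<forall>a\<in>A. \<forall>b\<in>B. \<kappa>\<^sub>1 a \<otimes>\<^bsub>W\<^esub> \<kappa>\<^sub>2 b = \<kappa>\<^sub>2 b \<otimes>\<^bsub>W\<^esub> \<kappa>\<^sub>1 a)"

definition in_symmetric_variety :: "'a pmv \<Rightarrow> bool"
  where "in_symmetric_variety A \<longleftrightarrow> in_class_M A \<and> pmv_symmetric A"

text \<open>HOL cannot quantify over all algebras of the variety inside a formula, so the unital
  \<open>\<ell>\<close>-groups \<open>(W, w)\<close> range over those carried by subsets of a type \<open>'w\<close>, which is
  a parameter of the notion.

  The embeddings \<open>\<phi>\<^sub>1\<close>, \<open>\<phi>\<^sub>2\<close> are themselves required to commute, the sums being formed in a
  unital \<open>\<ell>\<close>-group representing \<open>P\<close>. Without this the universal property, which concerns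
  commuting pairs only, would not determine \<open>P\<close> up to isomorphism: a non-commuting pair of
  embeddings can satisfy it too.\<close>

definition weak_free_product ::
    "'w itself \<Rightarrow> 'a pmv \<Rightarrow> 'b pmv \<Rightarrow> 'p pmv \<Rightarrow> ('a \<Rightarrow> 'p) \<Rightarrow> ('b \<Rightarrow> 'p) \<Rightarrow> bool"
  where "weak_free_product (_ :: 'w itself) A\<^sub>1 A\<^sub>2 P \<phi>\<^sub>1 \<phi>\<^sub>2 \<longleftrightarrow>
    in_symmetric_variety P \<and>
    \<phi>\<^sub>1 \<in> pmv_hom A\<^sub>1 P \<and> inj_on \<phi>\<^sub>1 (carrier A\<^sub>1) \<and>
    \<phi>\<^sub>2 \<in> pmv_hom A\<^sub>2 P \<and> inj_on \<phi>\<^sub>2 (carrier A\<^sub>2) \<and>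
    (\<exists>(W :: 'w ordered_group) w \<iota>. unital_l_group W w \<and> \<iota> \<in> pmv_iso P (Gamma W w) \<and>
       commuting_sums W (carrier A\<^sub>1) (carrier A\<^sub>2) (\<iota> \<circ> \<phi>\<^sub>1) (\<iota> \<circ> \<phi>\<^sub>2)) \<and>
    pmv_span P (\<phi>\<^sub>1 ` carrier A\<^sub>1 \<union> \<phi>\<^sub>2 ` carrier A\<^sub>2) = carrier P \<and>
    (\<forall>(W :: 'w ordered_group) w \<kappa>\<^sub>1 \<kappa>\<^sub>2.
       unital_l_group W w \<longrightarrow> in_symmetric_variety (Gamma W w) \<longrightarrow>
       \<kappa>\<^sub>1 \<in> pmv_hom A\<^sub>1 (Gamma W w) \<longrightarrow> \<kappa>\<^sub>2 \<in> pmv_hom A\<^sub>2 (Gamma W w) \<longrightarrow>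
       commuting_sums W (carrier A\<^sub>1) (carrier A\<^sub>2) \<kappa>\<^sub>1 \<kappa>\<^sub>2 \<longrightarrow>
       (\<exists>!\<psi>. \<psi> \<in> pmv_hom P (Gamma W w) \<inter> extensional (carrier P) \<and>
          (\<forall>a\<in>carrier A\<^sub>1. \<psi> (\<phi>\<^sub>1 a) = \<kappa>\<^sub>1 a) \<and> (\<forall>b\<in>carrier A\<^sub>2. \<psi> (\<phi>\<^sub>2 b) = \<kappa>\<^sub>2 b)))"

end

theory Submission
  imports Defs "HOL-Library.Nat_Bijection"
begin

text \<open>
  The algebra \<open>N\<close> is itself a weak free product of \<open>M/I\<close> and \<open>\<langle>I\<rangle>\<close>: the embeddings are
  \<open>h \<mapsto> (h, 0)\<close> and \<open>(n, g) \<mapsto> (n, g)\<close>, and a commuting pair \<open>\<kappa>\<^sub>1, \<kappa>\<^sub>2\<close> into \<open>\<Gamma>(W, w)\<close> extends by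
  \<open>\<psi>(h, g) = \<kappa>\<^sub>1(h) + K(g)\<close>, where \<open>K\<close> is the group homomorphism \<open>G \<rightarrow> W\<close> determined on the positive
  cone by \<open>g \<mapsto> \<kappa>\<^sub>2(0, g)\<close>. The point is that \<open>K(g) \<le> \<kappa>\<^sub>1(h)\<close> whenever \<open>h > 0\<close>: if \<open>n h \<ge> 1\<close>, then
  \<open>n \<kappa>\<^sub>2(0, g) \<le> w \<le> n \<kappa>\<^sub>1(h)\<close> for \<open>g \<ge> 0\<close>, and multiples can be cancelled because the two elements
  commute. Hence \<open>\<psi>\<close> respects the lexicographic order. Since weak free products are unique up to
  isomorphism, \<open>M\<close> is isomorphic to one of them iff it is isomorphic to \<open>N\<close>.
\<close>

section \<open>Quotients by normal ideals\<close>

text \<open>The universal property is tested only on unital l-groups carried by subsets of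
  \<open>'w\<close>, whereas the group behind \<open>N\<close> lives on pairs of type
  \<open>real \<times> 'g\<close>. So \<open>N\<close> can serve as a target only through a copy of
  that group inside \<open>'w\<close>, and the injection needed for the copy must be built from one
  of \<open>M\<close>: the unit interval of \<open>H\<close> is no larger than \<open>M/I\<close>,
  the positive cone of \<open>G\<close> sits in the generated subalgebra, and an infinite
  \<open>'w\<close> absorbs integer parts and pairs. Neither \<open>G\<close> nor \<open>W\<close>
  is assumed Abelian. Hence differences of cone elements are recombined by conjugation, and every
  exchange of a value of \<open>\<kappa>\<^sub>1\<close> with a value of \<open>K\<close> has to be
  derived from commutation on the two intervals. For uniqueness, the map from \<open>P\<close> to
  \<open>N\<close> comes from the universal property of \<open>P\<close>, while the map back is the
  extension \<open>\<psi>\<close> formed in a representation of \<open>P\<close> in which the two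
  embeddings commute. Normality of \<open>I\<close> enters through the quotient: it makes the
  operations of \<open>M/I\<close> preserve its carrier, so that the given isomorphism can be
  inverted.\<close>

locale symmetric_pseudo_MV = pseudo_MV +
  assumes rneg_eq: "x \<in> carrier M \<Longrightarrow> rneg M x = lneg M x"
begin

lemma neg_neg: "x \<in> carrier M \<Longrightarrow> lneg M (lneg M x) = x"
  using A8 lneg_closed rneg_eq by metis

lemma otimes_eq:
  "\<lbrakk>x \<in> carrier M; y \<in> carrier M\<rbrakk> \<Longrightarrow> x \<odot> y = lneg M (lneg M y \<oplus> lneg M x)"
  by (simp add: otimes_def rneg_eq lneg_closed oplus_closed)

lemma otimes_closed: "\<lbrakk>x \<in> carrier M; y \<in> carrier M\<rbrakk> \<Longrightarrow> x \<odot> y \<in> carrier M"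
  by (simp add: otimes_eq lneg_closed oplus_closed)

text \<open>Take \<open>y = 1\<close> in A6: the right-hand side is absorbed by A3, and on the left
  \<open>rneg M x \<odot> pmv_one M\<close> collapses to \<open>lneg M x\<close>.\<close>

lemma oplus_neg:
  assumes "x \<in> carrier M" shows "x \<oplus> lneg M x = pmv_one M"
proof -
  have "x \<oplus> (rneg M x \<odot> pmv_one M) = pmv_one M"
    using A6(1)[OF assms unit_closed] assms
    by (simp add: A3 otimes_closed rneg_closed unit_closed)
  then show ?thesis
    using assms by (simp add: rneg_eq otimes_eq A4 A2 lneg_closed unit_closed neg_neg)
qed

lemma neg_oplus: "x \<in> carrier M \<Longrightarrow> lneg M x \<oplus> x = pmv_one M"
  using oplus_neg[of "lneg M x"] by (simp add: neg_neg lneg_closed)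

text \<open>This makes the order equational. If \<open>y\<close> is \<open>x\<close> plus something,
  then \<open>lneg M x\<close> and \<open>x\<close> add up to 1 and absorb the rest. Conversely,
  negating the equation gives \<open>rneg M y \<odot> x = 0\<close>, and A6 then reduces the join to
  \<open>y\<close>.\<close>

lemma le_iff_left:
  assumes x: "x \<in> carrier M" and y: "y \<in> carrier M"
  shows "pmv_le M x y \<longleftrightarrow> lneg M x \<oplus> y = pmv_one M"
proof
  assume "pmv_le M x y"
  then have y': "x \<oplus> (rneg M x \<odot> y) = y"
    by (simp add: pmv_le_def pmv_join_def)
  have "lneg M x \<oplus> (x \<oplus> (rneg M x \<odot> y)) = pmv_one M"
    using x y by (simp add: A1 neg_oplus A3 lneg_closed rneg_closed otimes_closed)
  then show "lneg M x \<oplus> y = pmv_one M" by (simp add: y')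
next
  assume "lneg M x \<oplus> y = pmv_one M"
  then have "rneg M y \<odot> x = pmv_zero M"
    using x y by (simp add: rneg_eq otimes_eq lneg_closed neg_neg A4)
  then show "pmv_le M x y"
    using A6(1)[OF x y] y by (simp add: pmv_le_def pmv_join_def A2)
qed

lemma le_iff_right:
  assumes x: "x \<in> carrier M" and y: "y \<in> carrier M"
  shows "pmv_le M x y \<longleftrightarrow> y \<oplus> lneg M x = pmv_one M"
proof
  assume "pmv_le M x y"
  then have "x \<oplus> (rneg M x \<odot> y) = y"
    by (simp add: pmv_le_def pmv_join_def)
  then have y': "(y \<odot> lneg M x) \<oplus> x = y"
    using A6[OF x y] by simp
  have "((y \<odot> lneg M x) \<oplus> x) \<oplus> lneg M x = pmv_one M"
    using x y by (simp add: A1[symmetric] oplus_neg A3 lneg_closed otimes_closed)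
  then show "y \<oplus> lneg M x = pmv_one M" by (simp add: y')
next
  assume "y \<oplus> lneg M x = pmv_one M"
  then have "x \<odot> lneg M y = pmv_zero M"
    using x y by (simp add: otimes_eq lneg_closed neg_neg A4)
  then show "pmv_le M x y"
    using A6[OF x y] y by (simp add: pmv_le_def pmv_join_def A2)
qed

lemma le_refl: "x \<in> carrier M \<Longrightarrow> pmv_le M x x"
  by (simp add: le_iff_left neg_oplus)

lemma le_oplus:
  assumes "x \<in> carrier M" "z \<in> carrier M"
  shows "pmv_le M x (x \<oplus> z)" and "pmv_le M x (z \<oplus> x)"
proof -
  show "pmv_le M x (x \<oplus> z)"
    using assms by (simp add: le_iff_left oplus_closed A1 lneg_closed neg_oplus A3)
  show "pmv_le M x (z \<oplus> x)"
    using assms by (simp add: le_iff_right oplus_closed A1[symmetric] lneg_closed oplus_neg A3)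
qed

lemma leD:
  assumes "pmv_le M x y" "x \<in> carrier M" "y \<in> carrier M"
  obtains z z' where "z \<in> carrier M" "z' \<in> carrier M" "y = x \<oplus> z" "y = z' \<oplus> x"
proof (rule that)
  have e: "x \<oplus> (rneg M x \<odot> y) = y"
    using assms(1) by (simp add: pmv_le_def pmv_join_def)
  then show "y = x \<oplus> (rneg M x \<odot> y)" ..
  show "y = (y \<odot> lneg M x) \<oplus> x" using A6[OF assms(2,3)] e by simp
qed (use assms in \<open>simp_all add: otimes_closed rneg_closed lneg_closed\<close>)

lemma le_trans:
  assumes "pmv_le M x y" "pmv_le M y z" "x \<in> carrier M" "y \<in> carrier M" "z \<in> carrier M"
  shows "pmv_le M x z"
proof -
  obtain a where a: "a \<in> carrier M" "y = x \<oplus> a" using leD[OF assms(1,3,4)] by blast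
  obtain b where b: "b \<in> carrier M" "z = y \<oplus> b" using leD[OF assms(2,4,5)] by blast
  have "z = x \<oplus> (a \<oplus> b)" using a b assms by (simp add: A1)
  then show ?thesis using le_oplus(1)[of x "a \<oplus> b"] a b assms by (simp add: oplus_closed)
qed

lemma oplus_mono:
  assumes "pmv_le M x y" "pmv_le M x' y'"
    and c: "x \<in> carrier M" "y \<in> carrier M" "x' \<in> carrier M" "y' \<in> carrier M"
  shows "pmv_le M (x \<oplus> x') (y \<oplus> y')"
proof -
  obtain a where a: "a \<in> carrier M" "y = a \<oplus> x" using leD[OF assms(1) c(1,2)] by blast
  obtain b where b: "b \<in> carrier M" "y' = x' \<oplus> b" using leD[OF assms(2) c(3,4)] by blast
  have "pmv_le M (x \<oplus> x') ((x \<oplus> x') \<oplus> b)"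
    using a b c by (simp add: le_oplus oplus_closed)
  moreover have "pmv_le M \<dots> (a \<oplus> ((x \<oplus> x') \<oplus> b))"
    using a b c by (simp add: le_oplus oplus_closed)
  moreover have "y \<oplus> y' = a \<oplus> ((x \<oplus> x') \<oplus> b)"
    using a b c by (simp add: A1 oplus_closed)
  ultimately show ?thesis
    using le_trans a b c by (simp add: oplus_closed)
qed

lemma neg_otimes: "\<lbrakk>x \<in> carrier M; y \<in> carrier M\<rbrakk> \<Longrightarrow> lneg M (x \<odot> y) = lneg M y \<oplus> lneg M x"
  by (simp add: otimes_eq neg_neg oplus_closed lneg_closed)

text \<open>Once the negation of the product is expanded, both sides of each equivalence are the
  same equation up to associativity.\<close>

lemma residuation:
  assumes "x \<in> carrier M" "y \<in> carrier M" "z \<in> carrier M"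
  shows "pmv_le M (x \<odot> y) z \<longleftrightarrow> pmv_le M y (lneg M x \<oplus> z)"
    and "pmv_le M (x \<odot> y) z \<longleftrightarrow> pmv_le M x (z \<oplus> lneg M y)"
proof -
  show "pmv_le M (x \<odot> y) z \<longleftrightarrow> pmv_le M y (lneg M x \<oplus> z)"
    using assms by (simp add: le_iff_left otimes_closed oplus_closed lneg_closed neg_otimes A1)
  show "pmv_le M (x \<odot> y) z \<longleftrightarrow> pmv_le M x (z \<oplus> lneg M y)"
    using assms by (simp add: le_iff_right otimes_closed oplus_closed lneg_closed neg_otimes A1)
qed

end

section \<open>Congruence modulo a normal ideal\<close>

locale normal_ideal = symmetric_pseudo_MV +
  fixes I
  assumes normal: "pmv_normal_ideal M I"
begin

lemma ideal: "pmv_ideal M I"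
  using normal by (simp add: pmv_normal_ideal_def)

lemma I_closed: "i \<in> I \<Longrightarrow> i \<in> carrier M"
  using ideal by (auto simp: pmv_ideal_def)

lemma I_oplus: "i \<in> I \<Longrightarrow> j \<in> I \<Longrightarrow> i \<oplus> j \<in> I"
  using ideal by (auto simp: pmv_ideal_def)

lemma I_down: "i \<in> I \<Longrightarrow> x \<in> carrier M \<Longrightarrow> pmv_le M x i \<Longrightarrow> x \<in> I"
  using ideal by (auto simp: pmv_ideal_def)

lemma I_swap:
  assumes "x \<in> carrier M" "i \<in> I"
  shows "\<exists>j\<in>I. x \<oplus> i = j \<oplus> x" and "\<exists>j\<in>I. i \<oplus> x = x \<oplus> j"
  using assms normal unfolding pmv_normal_ideal_def by (blast, blast)

text \<open>Residuation trades the difference for an inequality up to an error from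
  \<open>I\<close>. In this form transitivity and compatibility with \<open>\<oplus>\<close> amount
  to adding inequalities and collecting the errors on the left.\<close>

lemma diff_in_I_iff:
  assumes x: "x \<in> carrier M" and y: "y \<in> carrier M"
  shows "x \<odot> lneg M y \<in> I \<longleftrightarrow> (\<exists>i\<in>I. pmv_le M x (i \<oplus> y))"
proof -
  have "x \<odot> lneg M y \<in> I \<longleftrightarrow> (\<exists>i\<in>I. pmv_le M (x \<odot> lneg M y) i)"
    using le_refl I_down x y by (meson lneg_closed otimes_closed)
  also have "\<dots> \<longleftrightarrow> (\<exists>i\<in>I. pmv_le M x (i \<oplus> y))"
    using residuation(2)[of x "lneg M y"] x y by (simp add: I_closed lneg_closed neg_neg)
  finally show ?thesis .
qed

lemma diff_refl: "x \<in> carrier M \<Longrightarrow> x \<odot> lneg M x \<in> I"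
  using ideal I_closed by (fastforce simp: diff_in_I_iff pmv_ideal_def intro: le_oplus)

lemma diff_trans:
  assumes "x \<odot> lneg M y \<in> I" "y \<odot> lneg M z \<in> I"
    and c: "x \<in> carrier M" "y \<in> carrier M" "z \<in> carrier M"
  shows "x \<odot> lneg M z \<in> I"
proof -
  obtain i where i: "i \<in> I" "pmv_le M x (i \<oplus> y)" using assms by (auto simp: diff_in_I_iff)
  obtain j where j: "j \<in> I" "pmv_le M y (j \<oplus> z)" using assms by (auto simp: diff_in_I_iff)
  have "pmv_le M (i \<oplus> y) (i \<oplus> (j \<oplus> z))"
    using i j c by (intro oplus_mono le_refl) (auto simp: I_closed oplus_closed)
  then have "pmv_le M x ((i \<oplus> j) \<oplus> z)"
    using le_trans[OF i(2)] i j c by (simp add: I_closed oplus_closed A1)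
  then show ?thesis using i j c I_oplus by (auto simp: diff_in_I_iff)
qed

lemma diff_oplus:
  assumes "x \<odot> lneg M y \<in> I" "x' \<odot> lneg M y' \<in> I"
    and c: "x \<in> carrier M" "y \<in> carrier M" "x' \<in> carrier M" "y' \<in> carrier M"
  shows "(x \<oplus> x') \<odot> lneg M (y \<oplus> y') \<in> I"
proof -
  obtain i where i: "i \<in> I" "pmv_le M x (i \<oplus> y)" using assms by (auto simp: diff_in_I_iff)
  obtain j where j: "j \<in> I" "pmv_le M x' (j \<oplus> y')" using assms by (auto simp: diff_in_I_iff)
  \<comment> \<open>Normality carries the error \<open>j\<close> past \<open>y\<close>, so that it
    joins \<open>i\<close> on the left.\<close>
  obtain k where k: "k \<in> I" "y \<oplus> j = k \<oplus> y" using I_swap(1)[OF c(2) j(1)] by blast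
  have "(i \<oplus> y) \<oplus> (j \<oplus> y') = i \<oplus> ((y \<oplus> j) \<oplus> y')"
    using i j c by (simp add: A1 I_closed oplus_closed)
  also have "\<dots> = (i \<oplus> k) \<oplus> (y \<oplus> y')"
    using i k c by (simp add: A1 I_closed oplus_closed)
  finally have "pmv_le M (x \<oplus> x') ((i \<oplus> k) \<oplus> (y \<oplus> y'))"
    using oplus_mono[OF i(2) j(2)] i j c by (simp add: I_closed oplus_closed)
  then show ?thesis using i k c I_oplus by (auto simp: diff_in_I_iff oplus_closed)
qed

text \<open>Residuating in the first factor leaves the error on the right of
  \<open>lneg M x\<close>; normality moves it to the left, where \<open>diff_in_I_iff\<close>
  expects it.\<close>

lemma diff_neg:
  assumes "x \<odot> lneg M y \<in> I" and c: "x \<in> carrier M" "y \<in> carrier M"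
  shows "lneg M y \<odot> lneg M (lneg M x) \<in> I"
proof -
  obtain i where i: "i \<in> I" "pmv_le M (x \<odot> lneg M y) i"
    using assms le_refl by (meson lneg_closed otimes_closed)
  then have le: "pmv_le M (lneg M y) (lneg M x \<oplus> i)"
    using residuation(1)[of x "lneg M y"] c by (simp add: I_closed lneg_closed)
  obtain j where "j \<in> I" "lneg M x \<oplus> i = j \<oplus> lneg M x"
    using I_swap(1)[OF lneg_closed[OF c(1)] i(1)] by blast
  then show ?thesis using le c by (auto simp: diff_in_I_iff lneg_closed)
qed

text \<open>A sum lies in an ideal iff both summands do, since each summand is below the
  sum.\<close>

lemma pmv_class_iff:
  assumes "x \<in> carrier M"
  shows "y \<in> pmv_class M I x \<longleftrightarrow>
    y \<in> carrier M \<and> x \<odot> lneg M y \<in> I \<and> y \<odot> lneg M x \<in> I"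
proof -
  have "a \<oplus> b \<in> I \<longleftrightarrow> a \<in> I \<and> b \<in> I" if "a \<in> carrier M" "b \<in> carrier M" for a b
    using that I_oplus I_down le_oplus by blast
  then show ?thesis
    using assms by (auto simp: pmv_class_def otimes_closed lneg_closed)
qed

lemma pmv_class_eq:
  assumes "x \<in> carrier M" "y \<in> pmv_class M I x"
  shows "pmv_class M I y = pmv_class M I x"
  using assms by (auto simp: pmv_class_iff intro: diff_trans)

lemma pmv_class_self: "x \<in> carrier M \<Longrightarrow> x \<in> pmv_class M I x"
  by (simp add: pmv_class_iff diff_refl)

lemma quotient_oplus:
  assumes c: "x \<in> carrier M" "y \<in> carrier M"
  shows "pmv_class M I x \<oplus>\<^bsub>pmv_quotient M I\<^esub> pmv_class M I y = pmv_class M I (x \<oplus> y)"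
proof -
  define C where "C = pmv_class M I (x \<oplus> y)"
  have "pmv_class M I (x' \<oplus> y') = C"
    if "x' \<in> pmv_class M I x" "y' \<in> pmv_class M I y" for x' y'
    unfolding C_def
    using that c by (intro pmv_class_eq) (auto simp: pmv_class_iff oplus_closed diff_oplus)
  then have "(\<Union>x'\<in>pmv_class M I x. \<Union>y'\<in>pmv_class M I y. pmv_class M I (x' \<oplus> y')) = C"
    using pmv_class_self[OF c(1)] pmv_class_self[OF c(2)] by auto
  then show ?thesis by (simp add: pmv_quotient_def C_def)
qed

lemma quotient_lneg:
  assumes c: "x \<in> carrier M"
  shows "lneg (pmv_quotient M I) (pmv_class M I x) = pmv_class M I (lneg M x)"
proof -
  define C where "C = pmv_class M I (lneg M x)"
  have "pmv_class M I (lneg M x') = C" if "x' \<in> pmv_class M I x" for x'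
    unfolding C_def
    using that c by (intro pmv_class_eq) (auto simp: pmv_class_iff lneg_closed diff_neg)
  then have "(\<Union>x'\<in>pmv_class M I x. pmv_class M I (lneg M x')) = C"
    using pmv_class_self[OF c] by auto
  then show ?thesis by (simp add: pmv_quotient_def C_def)
qed

lemma quotient_rneg:
  assumes c: "x \<in> carrier M"
  shows "rneg (pmv_quotient M I) (pmv_class M I x) = pmv_class M I (rneg M x)"
proof -
  have "rneg M x' = lneg M x'" if "x' \<in> pmv_class M I x" for x'
    using that c by (simp add: pmv_class_iff rneg_eq)
  then show ?thesis
    using quotient_lneg[OF c] c by (simp add: pmv_quotient_def rneg_eq)
qed

end

text \<open>Operations of a record need not preserve its carrier; when they do, the inverse of a
  bijective homomorphism is a homomorphism.\<close>

definition pmv_closed :: "'a pmv \<Rightarrow> bool"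
  where "pmv_closed A \<longleftrightarrow> pmv_subuniverse A (carrier A)"

lemma (in pseudo_MV) pmv_closed: "pmv_closed M"
  by (simp add: pmv_closed_def pmv_subuniverse_def oplus_closed lneg_closed rneg_closed
      zero_closed unit_closed)

lemma (in normal_ideal) pmv_closed_quotient: "pmv_closed (pmv_quotient M I)"
proof -
  have "carrier (pmv_quotient M I) = pmv_class M I ` carrier M"
    "pmv_zero (pmv_quotient M I) = pmv_class M I (pmv_zero M)"
    "pmv_one (pmv_quotient M I) = pmv_class M I (pmv_one M)"
    by (simp_all add: pmv_quotient_def)
  then show ?thesis
    by (auto simp: pmv_closed_def pmv_subuniverse_def quotient_oplus quotient_lneg quotient_rneg
        oplus_closed lneg_closed rneg_closed zero_closed unit_closed)
qed

lemma pmv_subuniverse_span: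
  assumes "pmv_closed A" "X \<subseteq> carrier A"
  shows "pmv_subuniverse A (pmv_span A X)"
  using assms by (auto simp: pmv_span_def pmv_subuniverse_def pmv_closed_def)

lemma pmv_closed_generated_subalgebra:
  assumes "pmv_closed A" "X \<subseteq> carrier A"
  shows "pmv_closed (generated_subalgebra A X)"
  using pmv_subuniverse_span[OF assms]
  by (simp add: generated_subalgebra_def pmv_closed_def pmv_subuniverse_def)

text \<open>The equalizer of two homomorphisms is a subuniverse.\<close>

lemma pmv_hom_eq_on_span:
  assumes "f \<in> pmv_hom A B" "g \<in> pmv_hom A B" "pmv_closed A"
    and "X \<subseteq> carrier A" "\<And>x. x \<in> X \<Longrightarrow> f x = g x" "x \<in> pmv_span A X"
  shows "f x = g x"
proof -
  have "pmv_subuniverse A {x \<in> carrier A. f x = g x}"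
    using assms(1-3) by (auto simp: pmv_subuniverse_def pmv_hom_def pmv_closed_def)
  then show ?thesis using assms(4-6) by (auto simp: pmv_span_def)
qed

lemma pmv_hom_comp:
  assumes "f \<in> pmv_hom A B" "g \<in> pmv_hom B C"
  shows "g \<circ> f \<in> pmv_hom A C"
  using assms by (auto simp: pmv_hom_def Pi_iff)

lemma pmv_iso_inv:
  assumes f: "f \<in> pmv_iso A B" and A: "pmv_closed A"
  shows "inv_into (carrier A) f \<in> pmv_iso B A"
proof -
  let ?g = "inv_into (carrier A) f"
  have h: "f \<in> pmv_hom A B" and b: "bij_betw f (carrier A) (carrier B)"
    using f by (auto simp: pmv_iso_def)
  have g: "?g y \<in> carrier A" "f (?g y) = y" if "y \<in> carrier B" for y
    using that b by (auto simp: bij_betw_def inv_into_into f_inv_into_f)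
  have gf: "?g (f x) = x" if "x \<in> carrier A" for x
    using that b by (auto simp: bij_betw_def)
  have "?g y = x" if "x \<in> carrier A" "y = f x" for x y
    using gf that by simp
  note eq = this
  have "?g \<in> pmv_hom B A"
    unfolding pmv_hom_def
    using A h g by (auto intro!: eq simp: pmv_closed_def pmv_subuniverse_def pmv_hom_def)
  then show ?thesis using b by (simp add: pmv_iso_def bij_betw_inv_into)
qed

lemma pmv_iso_comp:
  assumes "f \<in> pmv_iso A B" "g \<in> pmv_iso B C"
  shows "g \<circ> f \<in> pmv_iso A C"
  using assms by (auto simp: pmv_iso_def intro: pmv_hom_comp bij_betw_trans)

section \<open>Lattice-ordered groups and their intervals\<close>

context l_group
begin

abbreviation meet where "meet x y \<equiv> x \<sqinter>\<^bsub>grp_order G\<^esub> y"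
abbreviation join where "join x y \<equiv> x \<squnion>\<^bsub>grp_order G\<^esub> y"

interpretation ord: Lattice.lattice "grp_order G"
  by (rule lattice_order)

lemma grp_le_refl: "x \<in> carrier G \<Longrightarrow> grp_le G x x"
  using ord.le_refl[of x] by (simp add: grp_order_def)

lemma grp_le_trans:
  "\<lbrakk>grp_le G x y; grp_le G y z; x \<in> carrier G; y \<in> carrier G; z \<in> carrier G\<rbrakk> \<Longrightarrow> grp_le G x z"
  using ord.le_trans[of x y z] by (simp add: grp_order_def)

lemma grp_le_antisym:
  "\<lbrakk>grp_le G x y; grp_le G y x; x \<in> carrier G; y \<in> carrier G\<rbrakk> \<Longrightarrow> x = y"
  using ord.le_antisym[of x y] by (simp add: grp_order_def)

lemma meet_closed: "\<lbrakk>x \<in> carrier G; y \<in> carrier G\<rbrakk> \<Longrightarrow> meet x y \<in> carrier G"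
  using ord.meet_closed[of x y] by (simp add: grp_order_def)

lemma meet_lower:
  assumes "x \<in> carrier G" "y \<in> carrier G"
  shows "grp_le G (meet x y) x" "grp_le G (meet x y) y"
  using ord.meet_left[of x y] ord.meet_right[of x y] assms by (simp_all add: grp_order_def)

lemma meet_greatest:
  "\<lbrakk>grp_le G z x; grp_le G z y; x \<in> carrier G; y \<in> carrier G; z \<in> carrier G\<rbrakk>
    \<Longrightarrow> grp_le G z (meet x y)"
  using ord.meet_le[of z x y] by (simp add: grp_order_def)

lemma join_closed: "\<lbrakk>x \<in> carrier G; y \<in> carrier G\<rbrakk> \<Longrightarrow> join x y \<in> carrier G"
  using ord.join_closed[of x y] by (simp add: grp_order_def)

lemma join_upper:
  assumes "x \<in> carrier G" "y \<in> carrier G"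
  shows "grp_le G x (join x y)" "grp_le G y (join x y)"
  using ord.join_left[of x y] ord.join_right[of x y] assms by (simp_all add: grp_order_def)

lemma join_least:
  "\<lbrakk>grp_le G x z; grp_le G y z; x \<in> carrier G; y \<in> carrier G; z \<in> carrier G\<rbrakk>
    \<Longrightarrow> grp_le G (join x y) z"
  using ord.join_le[of x z y] by (simp add: grp_order_def)

lemma meetI:
  assumes "x \<in> carrier G" "y \<in> carrier G" "z \<in> carrier G" "grp_le G z x" "grp_le G z y"
    and "\<And>l. \<lbrakk>l \<in> carrier G; grp_le G l x; grp_le G l y\<rbrakk> \<Longrightarrow> grp_le G l z"
  shows "meet x y = z"
  using assms by (intro grp_le_antisym) (auto simp: meet_closed meet_lower intro: meet_greatest)

lemma joinI:
  assumes "x \<in> carrier G" "y \<in> carrier G" "z \<in> carrier G" "grp_le G x z" "grp_le G y z"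
    and "\<And>l. \<lbrakk>l \<in> carrier G; grp_le G x l; grp_le G y l\<rbrakk> \<Longrightarrow> grp_le G z l"
  shows "join x y = z"
  using assms by (intro grp_le_antisym) (auto simp: join_closed join_upper intro: join_least)

lemma meet_absorb:
  assumes "grp_le G x y" "x \<in> carrier G" "y \<in> carrier G"
  shows "meet x y = x" "meet y x = x" "join x y = y" "join y x = y"
  using assms by (auto intro!: meetI joinI grp_le_refl)

lemma meet_comm: "\<lbrakk>x \<in> carrier G; y \<in> carrier G\<rbrakk> \<Longrightarrow> meet x y = meet y x"
  by (intro meetI) (auto simp: meet_closed meet_lower intro: meet_greatest)

lemma join_comm: "\<lbrakk>x \<in> carrier G; y \<in> carrier G\<rbrakk> \<Longrightarrow> join x y = join y x"
  by (intro joinI) (auto simp: join_closed join_upper intro: join_least)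

lemma meet_assoc:
  assumes "x \<in> carrier G" "y \<in> carrier G" "z \<in> carrier G"
  shows "meet (meet x y) z = meet x (meet y z)"
  using ord.meet_assoc[of x y z] assms by (simp add: grp_order_def)

lemma inv_cancel_left:
  "\<lbrakk>a \<in> carrier G; b \<in> carrier G\<rbrakk> \<Longrightarrow> inv a \<otimes> (a \<otimes> b) = b"
  "\<lbrakk>a \<in> carrier G; b \<in> carrier G\<rbrakk> \<Longrightarrow> a \<otimes> (inv a \<otimes> b) = b"
  by (simp_all flip: m_assoc)

lemma grp_le_mult_left_iff:
  assumes "a \<in> carrier G" "b \<in> carrier G" "c \<in> carrier G"
  shows "grp_le G (c \<otimes> a) (c \<otimes> b) \<longleftrightarrow> grp_le G a b"
  using le_mult_left[of a b c] le_mult_left[of "c \<otimes> a" "c \<otimes> b" "inv c"] assms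
  by (auto simp: inv_cancel_left)

lemma grp_le_mult_right_iff:
  assumes "a \<in> carrier G" "b \<in> carrier G" "c \<in> carrier G"
  shows "grp_le G (a \<otimes> c) (b \<otimes> c) \<longleftrightarrow> grp_le G a b"
  using le_mult_right[of a b c] le_mult_right[of "a \<otimes> c" "b \<otimes> c" "inv c"] assms
  by (auto simp: m_assoc)

lemma grp_le_inv_iff:
  assumes "a \<in> carrier G" "b \<in> carrier G"
  shows "grp_le G (inv a) (inv b) \<longleftrightarrow> grp_le G b a"
proof -
  have "grp_le G (inv a) (inv b) \<longleftrightarrow> grp_le G (b \<otimes> inv a) \<one>"
    using grp_le_mult_left_iff[of "inv a" "inv b" b] assms by simp
  also have "\<dots> \<longleftrightarrow> grp_le G b a"
    using grp_le_mult_right_iff[of "b \<otimes> inv a" \<one> a] assms by (simp add: m_assoc)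
  finally show ?thesis .
qed

lemma grp_le_left_mult_iff:
  assumes "a \<in> carrier G" "b \<in> carrier G" "c \<in> carrier G"
  shows "grp_le G (c \<otimes> a) b \<longleftrightarrow> grp_le G a (inv c \<otimes> b)"
    and "grp_le G (inv c \<otimes> a) b \<longleftrightarrow> grp_le G a (c \<otimes> b)"
  using grp_le_mult_left_iff[of "c \<otimes> a" b "inv c"] grp_le_mult_left_iff[of "inv c \<otimes> a" b c] assms
  by (simp_all add: inv_cancel_left)

lemma grp_le_right_mult_iff:
  assumes "a \<in> carrier G" "b \<in> carrier G" "c \<in> carrier G"
  shows "grp_le G (a \<otimes> c) b \<longleftrightarrow> grp_le G a (b \<otimes> inv c)"
    and "grp_le G (a \<otimes> inv c) b \<longleftrightarrow> grp_le G a (b \<otimes> c)"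
  using grp_le_mult_right_iff[of "a \<otimes> c" b "inv c"] grp_le_mult_right_iff[of "a \<otimes> inv c" b c] assms
  by (simp_all add: m_assoc)

lemma grp_le_mult_mono:
  assumes "grp_le G a b" "grp_le G c d"
    and "a \<in> carrier G" "b \<in> carrier G" "c \<in> carrier G" "d \<in> carrier G"
  shows "grp_le G (a \<otimes> c) (b \<otimes> d)"
  using grp_le_trans[of "a \<otimes> c" "b \<otimes> c" "b \<otimes> d"] assms
  by (simp add: grp_le_mult_left_iff grp_le_mult_right_iff)

lemma one_le_mult:
  assumes "grp_le G \<one> a" "grp_le G \<one> b" "a \<in> carrier G" "b \<in> carrier G"
  shows "grp_le G \<one> (a \<otimes> b)"
  using grp_le_mult_mono[of \<one> a \<one> b] assms by simp

lemma mult_meet_left: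
  assumes "a \<in> carrier G" "b \<in> carrier G" "c \<in> carrier G"
  shows "c \<otimes> meet a b = meet (c \<otimes> a) (c \<otimes> b)"
proof (rule meetI[symmetric])
  fix l assume "l \<in> carrier G" "grp_le G l (c \<otimes> a)" "grp_le G l (c \<otimes> b)"
  then have "grp_le G (inv c \<otimes> l) (meet a b)"
    using assms by (intro meet_greatest) (simp_all add: grp_le_left_mult_iff)
  then show "grp_le G l (c \<otimes> meet a b)"
    using assms \<open>l \<in> carrier G\<close> by (simp add: grp_le_left_mult_iff meet_closed)
qed (use assms in \<open>simp_all add: meet_closed grp_le_mult_left_iff meet_lower\<close>)

lemma mult_meet_right:
  assumes "a \<in> carrier G" "b \<in> carrier G" "c \<in> carrier G"
  shows "meet a b \<otimes> c = meet (a \<otimes> c) (b \<otimes> c)"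
proof (rule meetI[symmetric])
  fix l assume "l \<in> carrier G" "grp_le G l (a \<otimes> c)" "grp_le G l (b \<otimes> c)"
  then have "grp_le G (l \<otimes> inv c) (meet a b)"
    using assms by (intro meet_greatest) (simp_all add: grp_le_right_mult_iff)
  then show "grp_le G l (meet a b \<otimes> c)"
    using assms \<open>l \<in> carrier G\<close> by (simp add: grp_le_right_mult_iff meet_closed)
qed (use assms in \<open>simp_all add: meet_closed grp_le_mult_right_iff meet_lower\<close>)

lemma inv_meet:
  assumes "a \<in> carrier G" "b \<in> carrier G"
  shows "inv (meet a b) = join (inv a) (inv b)"
proof (rule joinI[symmetric])
  fix l assume "l \<in> carrier G" "grp_le G (inv a) l" "grp_le G (inv b) l"
  then have "grp_le G (inv l) (meet a b)"
    using assms grp_le_inv_iff[of l "inv a"] grp_le_inv_iff[of l "inv b"]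
    by (intro meet_greatest) simp_all
  then show "grp_le G (inv (meet a b)) l"
    using assms \<open>l \<in> carrier G\<close> grp_le_inv_iff[of "meet a b" "inv l"] by (simp add: meet_closed)
qed (use assms in \<open>simp_all add: meet_closed grp_le_inv_iff meet_lower\<close>)

lemma inv_join:
  assumes "a \<in> carrier G" "b \<in> carrier G"
  shows "inv (join a b) = meet (inv a) (inv b)"
  using inv_meet[of "inv a" "inv b"] assms by (metis inv_closed inv_inv meet_closed)

lemma mult_join_left:
  assumes "a \<in> carrier G" "b \<in> carrier G" "c \<in> carrier G"
  shows "c \<otimes> join a b = join (c \<otimes> a) (c \<otimes> b)"
proof -
  have "inv (c \<otimes> join a b) = inv (join (c \<otimes> a) (c \<otimes> b))"
    using assms by (simp add: inv_mult_group inv_join join_closed mult_meet_right)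
  then show ?thesis using assms by (metis inv_inv m_closed join_closed)
qed

lemma mult_join_right:
  assumes "a \<in> carrier G" "b \<in> carrier G" "c \<in> carrier G"
  shows "join a b \<otimes> c = join (a \<otimes> c) (b \<otimes> c)"
proof -
  have "inv (join a b \<otimes> c) = inv (join (a \<otimes> c) (b \<otimes> c))"
    using assms by (simp add: inv_mult_group inv_join join_closed mult_meet_left)
  then show ?thesis using assms by (metis inv_inv m_closed join_closed)
qed

text \<open>A normalizing rule set: products and inverses are pushed inside the lattice operations,
  so that identities in \<open>Gamma G u\<close> become lattice identities between group
  words.\<close>

lemmas meet_join_simps = meet_closed join_closed m_assoc inv_mult_group inv_cancel_left
  mult_meet_left mult_meet_right mult_join_left mult_join_right inv_meet inv_join

text \<open>With \<open>m\<close> the infimum of \<open>x\<^sup>i\<close> for \<open>i < n\<close>, the hypothesis yields \<open>m \<le> x m\<close>.\<close>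

lemma one_le_of_one_le_pow:
  assumes x: "x \<in> carrier G" and le: "grp_le G \<one> (x [^] n)" and n: "0 < (n :: nat)"
  shows "grp_le G \<one> x"
proof -
  have inf: "\<exists>m\<in>carrier G. (\<forall>i<k. grp_le G m (x [^] i)) \<and>
      (\<forall>l\<in>carrier G. (\<forall>i<k. grp_le G l (x [^] i)) \<longrightarrow> grp_le G l m)" if "0 < k" for k :: nat
    using that
  proof (induction k rule: nat_induct_non_zero)
    case 1
    then show ?case by (intro bexI[of _ \<one>]) (auto simp: grp_le_refl)
  next
    case (Suc k)
    then obtain m where m: "m \<in> carrier G" "\<And>i. i < k \<Longrightarrow> grp_le G m (x [^] i)"
      "\<And>l. \<lbrakk>l \<in> carrier G; \<And>i. i < k \<Longrightarrow> grp_le G l (x [^] i)\<rbrakk> \<Longrightarrow> grp_le G l m"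
      by blast
    note m' = meet_lower[of m "x [^] k"] meet_closed[of m "x [^] k"]
    have "grp_le G (meet m (x [^] k)) (x [^] i)" if "i < Suc k" for i
      using that m' m(1,2) x grp_le_trans[of "meet m (x [^] k)" m "x [^] i"]
      by (cases "i = k") (auto simp: less_Suc_eq)
    moreover have "grp_le G l (meet m (x [^] k))"
      if "l \<in> carrier G" "\<And>i. i < Suc k \<Longrightarrow> grp_le G l (x [^] i)" for l
      using that m x by (intro meet_greatest) auto
    ultimately show ?case using m' m(1) x by blast
  qed
  from inf[OF n] obtain m where m: "m \<in> carrier G"
    and m': "(\<forall>i<n. grp_le G m (x [^] i)) \<and>
      (\<forall>l\<in>carrier G. (\<forall>i<n. grp_le G l (x [^] i)) \<longrightarrow> grp_le G l m)" ..
  \<comment> \<open>For \<open>Suc i < n\<close> this is the choice of \<open>m\<close>; the last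
    exponent closes the cycle, because \<open>m \<le> x^0 = 1 \<le> x^n\<close>. Thus
    \<open>inv x \<otimes> m\<close> is again a lower bound of the first \<open>n\<close> powers,
    hence below their infimum \<open>m\<close>.\<close>
  have "grp_le G m (x \<otimes> x [^] i)" if "i < n" for i
  proof (cases "Suc i < n")
    case True
    then show ?thesis using m' x by (metis nat_pow_Suc2)
  next
    case False
    then have "Suc i = n" using that by simp
    then show ?thesis
      using grp_le_trans[OF _ le] m m' n x by (metis nat_pow_0 nat_pow_Suc2 nat_pow_closed one_closed)
  qed
  then have "grp_le G (inv x \<otimes> m) m"
    using m m' x by (simp add: grp_le_left_mult_iff)
  then have "grp_le G (\<one> \<otimes> m) (x \<otimes> m)"
    using m x by (simp add: grp_le_left_mult_iff)
  then show ?thesis using m x by (subst (asm) grp_le_mult_right_iff) simp_all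
qed

text \<open>For commuting elements \<open>(inv x \<otimes> y) [^] n\<close> splits into the two
  powers, which reduces the claim to the isolated case of a single element with a positive
  power.\<close>

lemma grp_le_of_pow_le:
  assumes "x \<in> carrier G" "y \<in> carrier G" "x \<otimes> y = y \<otimes> x"
    and "grp_le G (x [^] n) (y [^] n)" "0 < (n :: nat)"
  shows "grp_le G x y"
proof -
  have c: "inv x \<otimes> y = y \<otimes> inv x"
    using assms(1-3) by (metis inv_cancel_left(1) inv_closed m_assoc m_closed r_inv r_one)
  have "grp_le G \<one> (inv (x [^] n) \<otimes> y [^] n)"
    using assms by (simp flip: grp_le_left_mult_iff)
  also have "inv (x [^] n) \<otimes> y [^] n = (inv x \<otimes> y) [^] n"
    using assms(1,2) pow_mult_distrib[OF c, of n] by (simp add: nat_pow_inv)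
  finally have "grp_le G \<one> (inv x \<otimes> y)"
    using one_le_of_one_le_pow[of "inv x \<otimes> y" n] assms(1,2,5) by simp
  then show ?thesis using assms(1,2) by (simp flip: grp_le_left_mult_iff)
qed

text \<open>The decomposition into positive and negative part: additively, \<open>b\<close> is
  \<open>-(g \<and> 0)\<close> and \<open>a\<close> is \<open>g + b\<close>. The explicit values
  make the choice a function of \<open>g\<close>, as needed for defining \<open>ext\<close> and for
  embedding \<open>G\<close> into pairs of cone elements.\<close>

lemma difference:
  assumes g: "g \<in> carrier G"
  obtains a b where "a \<in> carrier G" "b \<in> carrier G" "grp_le G \<one> a" "grp_le G \<one> b" "g = a \<otimes> inv b"
    "a = g \<otimes> inv (meet g \<one>)" "b = inv (meet g \<one>)"
proof (rule that[OF _ _ _ _ _ refl refl])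
  let ?m = "meet g \<one>"
  have m: "?m \<in> carrier G" "grp_le G ?m g" "grp_le G ?m \<one>"
    using g meet_lower[of g \<one>] by (simp_all add: meet_closed)
  show "grp_le G \<one> (inv ?m)" using m grp_le_inv_iff[of \<one> ?m] by simp
  show "grp_le G \<one> (g \<otimes> inv ?m)" using g m by (simp flip: grp_le_right_mult_iff)
  show "g = g \<otimes> inv ?m \<otimes> inv (inv ?m)" using g m by (simp add: m_assoc)
  show "g \<otimes> inv ?m \<in> carrier G" "inv ?m \<in> carrier G" using g m by simp_all
qed

section \<open>Unit intervals as pseudo MV-algebras\<close>

lemma Gamma_simps:
  "carrier (Gamma G u) = {g \<in> carrier G. grp_le G \<one> g \<and> grp_le G g u}"
  "x \<oplus>\<^bsub>Gamma G u\<^esub> y = meet (x \<otimes> y) u"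
  "lneg (Gamma G u) x = u \<otimes> inv x"
  "rneg (Gamma G u) x = inv x \<otimes> u"
  "pmv_zero (Gamma G u) = \<one>"
  "pmv_one (Gamma G u) = u"
  by (simp_all add: Gamma_def)

lemma Gamma_otimes:
  assumes "x \<in> carrier G" "y \<in> carrier G" "u \<in> carrier G"
  shows "x \<odot>\<^bsub>Gamma G u\<^esub> y = join (x \<otimes> inv u \<otimes> y) \<one>"
  using assms by (simp add: otimes_def Gamma_simps meet_join_simps)

end

locale l_group_interval = l_group +
  fixes u
  assumes u_closed: "u \<in> carrier G" and one_le_u: "grp_le G \<one> u"
begin

text \<open>Every side of A6 is of one of these two forms, so A6 becomes commutativity of the join.
  The truncation at \<open>u\<close> has no effect because both arguments are below
  \<open>u\<close>.\<close>

lemma Gamma_join: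
  assumes "x \<in> carrier (Gamma G u)" "y \<in> carrier (Gamma G u)"
  shows "x \<oplus>\<^bsub>Gamma G u\<^esub> (rneg (Gamma G u) x \<odot>\<^bsub>Gamma G u\<^esub> y) = join x y"
    and "(x \<odot>\<^bsub>Gamma G u\<^esub> lneg (Gamma G u) y) \<oplus>\<^bsub>Gamma G u\<^esub> y = join x y"
proof -
  have "meet (join x y) u = join x y"
    using assms u_closed by (intro meet_absorb) (auto simp: Gamma_simps join_closed intro: join_least)
  then show "x \<oplus>\<^bsub>Gamma G u\<^esub> (rneg (Gamma G u) x \<odot>\<^bsub>Gamma G u\<^esub> y) = join x y"
    and "(x \<odot>\<^bsub>Gamma G u\<^esub> lneg (Gamma G u) y) \<oplus>\<^bsub>Gamma G u\<^esub> y = join x y"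
    using assms u_closed
    by (simp_all add: Gamma_simps Gamma_otimes meet_join_simps join_comm)
qed

lemma Gamma_meet:
  assumes "x \<in> carrier (Gamma G u)" "y \<in> carrier (Gamma G u)"
  shows "x \<odot>\<^bsub>Gamma G u\<^esub> (lneg (Gamma G u) x \<oplus>\<^bsub>Gamma G u\<^esub> y) = meet x y"
    and "(x \<oplus>\<^bsub>Gamma G u\<^esub> rneg (Gamma G u) y) \<odot>\<^bsub>Gamma G u\<^esub> y = meet x y"
proof -
  have "join (meet x y) \<one> = meet x y"
    using assms by (intro meet_absorb) (auto simp: Gamma_simps meet_closed intro: meet_greatest)
  then show "x \<odot>\<^bsub>Gamma G u\<^esub> (lneg (Gamma G u) x \<oplus>\<^bsub>Gamma G u\<^esub> y) = meet x y"
    and "(x \<oplus>\<^bsub>Gamma G u\<^esub> rneg (Gamma G u) y) \<odot>\<^bsub>Gamma G u\<^esub> y = meet x y"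
    using assms u_closed
    by (simp_all add: Gamma_simps Gamma_otimes meet_join_simps meet_comm)
qed

lemma pmv_le_Gamma:
  assumes "x \<in> carrier (Gamma G u)" "y \<in> carrier (Gamma G u)"
  shows "pmv_le (Gamma G u) x y \<longleftrightarrow> grp_le G x y"
  using assms join_upper[of x y] meet_absorb(3)[of x y]
  by (auto simp: pmv_le_def pmv_join_def Gamma_join) (auto simp: Gamma_simps)

text \<open>Adding a positive \<open>y\<close> keeps the truncation bound above \<open>u\<close>, so
  truncating an intermediate result changes nothing after the final truncation. Associativity of the
  truncated sum rests on this.\<close>

lemma meet_meet_u:
  assumes "x \<in> carrier G" "y \<in> carrier G" "grp_le G \<one> y"
  shows "meet (meet x u \<otimes> y) u = meet (x \<otimes> y) u" "meet (y \<otimes> meet x u) u = meet (y \<otimes> x) u"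
proof -
  have "grp_le G u (u \<otimes> y)" "grp_le G u (y \<otimes> u)"
    using grp_le_mult_mono[of u u \<one> y] grp_le_mult_mono[of \<one> y u u] assms u_closed
    by (auto simp: grp_le_refl)
  then show "meet (meet x u \<otimes> y) u = meet (x \<otimes> y) u" "meet (y \<otimes> meet x u) u = meet (y \<otimes> x) u"
    using assms u_closed by (simp_all add: mult_meet_left mult_meet_right meet_assoc meet_absorb)
qed

lemma pseudo_MV_Gamma: "pseudo_MV (Gamma G u)"
proof
  fix x y z
  assume x: "x \<in> carrier (Gamma G u)" and y: "y \<in> carrier (Gamma G u)" and z: "z \<in> carrier (Gamma G u)"
  have c: "x \<in> carrier G" "y \<in> carrier G" "z \<in> carrier G"
    and p: "grp_le G \<one> x" "grp_le G \<one> y" "grp_le G \<one> z"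
    and q: "grp_le G x u" "grp_le G y u" "grp_le G z u"
    using x y z by (auto simp: Gamma_simps)
  show "x \<oplus>\<^bsub>Gamma G u\<^esub> y \<in> carrier (Gamma G u)"
    using c p u_closed one_le_u
    by (auto simp: Gamma_simps meet_closed meet_lower intro: meet_greatest one_le_mult)
  show "x \<oplus>\<^bsub>Gamma G u\<^esub> (y \<oplus>\<^bsub>Gamma G u\<^esub> z) = x \<oplus>\<^bsub>Gamma G u\<^esub> y \<oplus>\<^bsub>Gamma G u\<^esub> z"
    using c p u_closed by (simp add: Gamma_simps meet_meet_u m_assoc)
  show "lneg (Gamma G u) x \<in> carrier (Gamma G u)" "rneg (Gamma G u) x \<in> carrier (Gamma G u)"
    using c p q u_closed
      grp_le_right_mult_iff[of \<one> u x] grp_le_right_mult_iff[of u u x]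
      grp_le_left_mult_iff[of \<one> u x] grp_le_left_mult_iff[of u u x]
      grp_le_mult_left_iff[of \<one> x u] grp_le_mult_right_iff[of \<one> x u]
    by (auto simp: Gamma_simps)
  show "x \<oplus>\<^bsub>Gamma G u\<^esub> pmv_zero (Gamma G u) = x" "pmv_zero (Gamma G u) \<oplus>\<^bsub>Gamma G u\<^esub> x = x"
    using c q u_closed by (simp_all add: Gamma_simps meet_absorb)
  show "x \<oplus>\<^bsub>Gamma G u\<^esub> pmv_one (Gamma G u) = pmv_one (Gamma G u)"
    "pmv_one (Gamma G u) \<oplus>\<^bsub>Gamma G u\<^esub> x = pmv_one (Gamma G u)"
    using c p u_closed grp_le_mult_mono[of \<one> x u u] grp_le_mult_mono[of u u \<one> x]
    by (simp_all add: Gamma_simps meet_absorb grp_le_refl)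
  show "rneg (Gamma G u) (lneg (Gamma G u) x \<oplus>\<^bsub>Gamma G u\<^esub> lneg (Gamma G u) y) =
      lneg (Gamma G u) (rneg (Gamma G u) x \<oplus>\<^bsub>Gamma G u\<^esub> rneg (Gamma G u) y)"
    using c u_closed by (simp add: Gamma_simps meet_join_simps)
  show "x \<oplus>\<^bsub>Gamma G u\<^esub> (rneg (Gamma G u) x \<odot>\<^bsub>Gamma G u\<^esub> y) =
      y \<oplus>\<^bsub>Gamma G u\<^esub> (rneg (Gamma G u) y \<odot>\<^bsub>Gamma G u\<^esub> x)"
    "y \<oplus>\<^bsub>Gamma G u\<^esub> (rneg (Gamma G u) y \<odot>\<^bsub>Gamma G u\<^esub> x) =
      (x \<odot>\<^bsub>Gamma G u\<^esub> lneg (Gamma G u) y) \<oplus>\<^bsub>Gamma G u\<^esub> y"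
    "(x \<odot>\<^bsub>Gamma G u\<^esub> lneg (Gamma G u) y) \<oplus>\<^bsub>Gamma G u\<^esub> y =
      (y \<odot>\<^bsub>Gamma G u\<^esub> lneg (Gamma G u) x) \<oplus>\<^bsub>Gamma G u\<^esub> x"
    using x y c by (simp_all add: Gamma_join join_comm)
  show "x \<odot>\<^bsub>Gamma G u\<^esub> (lneg (Gamma G u) x \<oplus>\<^bsub>Gamma G u\<^esub> y) =
      (x \<oplus>\<^bsub>Gamma G u\<^esub> rneg (Gamma G u) y) \<odot>\<^bsub>Gamma G u\<^esub> y"
    using x y by (simp add: Gamma_meet)
  show "rneg (Gamma G u) (lneg (Gamma G u) x) = x"
    using c u_closed by (simp add: Gamma_simps inv_mult_group m_assoc)
qed (use u_closed one_le_u in \<open>simp_all add: Gamma_simps grp_le_refl\<close>)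

end

text \<open>Binary infima suffice: inversion reverses the order, so the inverse of an infimum of
  inverses is a supremum.\<close>

lemma l_groupI:
  fixes G :: "'a ordered_group" (structure)
  assumes "group G"
    and refl: "\<And>x. x \<in> carrier G \<Longrightarrow> grp_le G x x"
    and antisym: "\<And>x y. \<lbrakk>x \<in> carrier G; y \<in> carrier G; grp_le G x y; grp_le G y x\<rbrakk> \<Longrightarrow> x = y"
    and trans: "\<And>x y z. \<lbrakk>x \<in> carrier G; y \<in> carrier G; z \<in> carrier G; grp_le G x y; grp_le G y z\<rbrakk>
      \<Longrightarrow> grp_le G x z"
    and left: "\<And>a b c. \<lbrakk>a \<in> carrier G; b \<in> carrier G; c \<in> carrier G; grp_le G a b\<rbrakk>
      \<Longrightarrow> grp_le G (c \<otimes> a) (c \<otimes> b)"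
    and right: "\<And>a b c. \<lbrakk>a \<in> carrier G; b \<in> carrier G; c \<in> carrier G; grp_le G a b\<rbrakk>
      \<Longrightarrow> grp_le G (a \<otimes> c) (b \<otimes> c)"
    and inf: "\<And>x y. \<lbrakk>x \<in> carrier G; y \<in> carrier G\<rbrakk> \<Longrightarrow> \<exists>z\<in>carrier G. grp_le G z x \<and> grp_le G z y \<and>
      (\<forall>l\<in>carrier G. grp_le G l x \<longrightarrow> grp_le G l y \<longrightarrow> grp_le G l z)"
  shows "l_group G"
proof -
  interpret group G by fact
  have inv: "grp_le G (inv b) (inv a)" if "a \<in> carrier G" "b \<in> carrier G" "grp_le G a b" for a b
    using left[of "a \<otimes> inv b" \<one> "inv a"] right[of a b "inv b"] that by (simp flip: m_assoc)
  have sup: "\<exists>z\<in>carrier G. grp_le G x z \<and> grp_le G y z \<and>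
      (\<forall>l\<in>carrier G. grp_le G x l \<longrightarrow> grp_le G y l \<longrightarrow> grp_le G z l)"
    if xy: "x \<in> carrier G" "y \<in> carrier G" for x y
  proof -
    obtain z where z: "z \<in> carrier G" "grp_le G z (inv x)" "grp_le G z (inv y)"
      "\<And>l. \<lbrakk>l \<in> carrier G; grp_le G l (inv x); grp_le G l (inv y)\<rbrakk> \<Longrightarrow> grp_le G l z"
      using inf[of "inv x" "inv y"] xy by auto
    have "grp_le G (inv z) l" if "l \<in> carrier G" "grp_le G x l" "grp_le G y l" for l
      using inv[of "inv l" z] z(4)[of "inv l"] inv[of x l] inv[of y l] that xy z(1) by simp
    then show ?thesis
      using z(1) inv[OF _ _ z(2)] inv[OF _ _ z(3)] xy by (intro bexI[of _ "inv z"]) auto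
  qed
  interpret partial_order "grp_order G"
    by unfold_locales (auto simp: grp_order_def intro: refl antisym trans)
  have "Lattice.lattice (grp_order G)"
  proof
    fix x y assume "x \<in> carrier (grp_order G)" "y \<in> carrier (grp_order G)"
    then have xy: "x \<in> carrier G" "y \<in> carrier G" by (simp_all add: grp_order_def)
    show "\<exists>s. least (grp_order G) s (Upper (grp_order G) {x, y})"
      using sup[OF xy] xy by (auto simp: least_def Upper_def grp_order_def)
    show "\<exists>s. greatest (grp_order G) s (Lower (grp_order G) {x, y})"
      using inf[OF xy] xy by (auto simp: greatest_def Lower_def grp_order_def)
  qed
  then show ?thesis
    using left right by (intro l_group.intro l_group_axioms.intro \<open>group G\<close>)
qed

section \<open>Lexicographic products\<close>

text \<open>Working over an arbitrary ordered ring lets the subgroup \<open>H\<close> of the reals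
  and the group of integers share one treatment of lexicographic products.\<close>

locale ordered_subgroup =
  fixes H :: "'a::linordered_idom set"
  assumes subgroup: "subgroup H (additive_group UNIV)" and one_in: "1 \<in> H"
begin

lemma zero_in: "0 \<in> H" and plus_in: "x \<in> H \<Longrightarrow> y \<in> H \<Longrightarrow> x + y \<in> H"
  using subgroup.one_closed[OF subgroup] subgroup.m_closed[OF subgroup]
  by (simp_all add: additive_group_def)

lemma uminus_in: "x \<in> H \<Longrightarrow> - x \<in> H"
proof -
  assume "x \<in> H"
  interpret group "additive_group (UNIV :: 'a set)"
    by (rule groupI) (auto simp: additive_group_def add.assoc intro: exI[of _ "- _"])
  have "inv\<^bsub>additive_group UNIV\<^esub> x = - x"
    by (rule inv_equality) (simp_all add: additive_group_def)
  then show "- x \<in> H" using subgroup.m_inv_closed[OF subgroup \<open>x \<in> H\<close>] by simp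
qed

lemma diff_in: "x \<in> H \<Longrightarrow> y \<in> H \<Longrightarrow> x - y \<in> H"
  using plus_in[OF _ uminus_in] by simp

lemma of_nat_in: "of_nat n \<in> H"
  by (induction n) (simp_all add: zero_in one_in plus_in)

lemma of_int_in: "of_int n \<in> H"
  by (cases n rule: int_cases2) (simp_all add: of_nat_in uminus_in)

lemma additive_group_simps:
  "carrier (additive_group H) = H" "x \<otimes>\<^bsub>additive_group H\<^esub> y = x + y"
  "\<one>\<^bsub>additive_group H\<^esub> = 0" "grp_le (additive_group H) x y \<longleftrightarrow> x \<le> y"
  by (simp_all add: additive_group_def)

lemma l_group_additive: "l_group (additive_group H)"
proof (rule l_groupI)
  show "group (additive_group H)"
    by (rule groupI) (auto simp: additive_group_simps zero_in plus_in intro: uminus_in bexI[of _ "- _"])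
  show "\<exists>z\<in>carrier (additive_group H). grp_le (additive_group H) z x \<and> grp_le (additive_group H) z y \<and>
      (\<forall>l\<in>carrier (additive_group H). grp_le (additive_group H) l x \<longrightarrow>
        grp_le (additive_group H) l y \<longrightarrow> grp_le (additive_group H) l z)"
    if "x \<in> carrier (additive_group H)" "y \<in> carrier (additive_group H)" for x y
    using that by (intro bexI[of _ "min x y"]) (auto simp: additive_group_simps min_def)
qed (simp_all add: additive_group_simps)

sublocale H: l_group_interval "additive_group H" 1
  by (intro l_group_interval.intro l_group_additive l_group_interval_axioms.intro)
     (simp_all add: additive_group_simps one_in)

lemma inv_additive: "x \<in> H \<Longrightarrow> inv\<^bsub>additive_group H\<^esub> x = - x"
  by (rule H.inv_equality) (simp_all add: additive_group_simps uminus_in)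

lemma meet_additive: "x \<in> H \<Longrightarrow> y \<in> H \<Longrightarrow> x \<sqinter>\<^bsub>grp_order (additive_group H)\<^esub> y = min x y"
  by (rule H.meetI) (auto simp: additive_group_simps min_def)

lemma Gamma_additive_simps:
  "carrier (Gamma (additive_group H) 1) = {h \<in> H. 0 \<le> h \<and> h \<le> 1}"
  "\<lbrakk>x \<in> H; y \<in> H\<rbrakk> \<Longrightarrow> x \<oplus>\<^bsub>Gamma (additive_group H) 1\<^esub> y = min (x + y) 1"
  "x \<in> H \<Longrightarrow> lneg (Gamma (additive_group H) 1) x = 1 - x"
  "x \<in> H \<Longrightarrow> rneg (Gamma (additive_group H) 1) x = 1 - x"
  "pmv_zero (Gamma (additive_group H) 1) = 0"
  "pmv_one (Gamma (additive_group H) 1) = 1"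
  by (simp_all add: H.Gamma_simps meet_additive plus_in one_in inv_additive additive_group_simps)

end

lemma lex_simps:
  "carrier (additive_group H \<times>\<^sub>l\<^sub>e\<^sub>x G) = H \<times> carrier G"
  "(h, g) \<otimes>\<^bsub>additive_group H \<times>\<^sub>l\<^sub>e\<^sub>x G\<^esub> (h', g') = (h + h', g \<otimes>\<^bsub>G\<^esub> g')"
  "\<one>\<^bsub>additive_group H \<times>\<^sub>l\<^sub>e\<^sub>x G\<^esub> = (0, \<one>\<^bsub>G\<^esub>)"
  "grp_le (additive_group H \<times>\<^sub>l\<^sub>e\<^sub>x G) (h, g) (h', g') \<longleftrightarrow> h < h' \<or> h = h' \<and> grp_le G g g'"
  for h h' :: "'a::linordered_idom"
  by (auto simp: lex_product_def additive_group_def)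

locale lex_l_group = ordered_subgroup H + l_group G
  for H :: "'a::linordered_idom set" and G :: "'g ordered_group" (structure)
begin

abbreviation "L \<equiv> additive_group H \<times>\<^sub>l\<^sub>e\<^sub>x G"

lemma l_group_lex: "l_group L"
proof (rule l_groupI)
  show "group L"
  proof (rule groupI)
    fix x assume "x \<in> carrier L"
    then show "\<exists>y\<in>carrier L. y \<otimes>\<^bsub>L\<^esub> x = \<one>\<^bsub>L\<^esub>"
      by (intro bexI[of _ "(- fst x, inv snd x)"]) (auto simp: lex_simps uminus_in)
  qed (auto simp: lex_simps zero_in plus_in m_assoc add.assoc)
  fix x y assume "x \<in> carrier L" "y \<in> carrier L"
  then show "\<exists>z\<in>carrier L. grp_le L z x \<and> grp_le L z y \<and>
      (\<forall>l\<in>carrier L. grp_le L l x \<longrightarrow> grp_le L l y \<longrightarrow> grp_le L l z)"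
    by (intro bexI[of _ "if fst x < fst y then x else if fst y < fst x then y
          else (fst x, meet (snd x) (snd y))"])
       (auto simp: lex_simps grp_le_refl meet_lower meet_closed meet_greatest)
qed (auto simp: lex_simps grp_le_refl intro: grp_le_antisym grp_le_trans le_mult_left le_mult_right)

sublocale L: l_group_interval L "(1, \<one>)"
  by (intro l_group_interval.intro l_group_lex l_group_interval_axioms.intro)
     (simp_all add: lex_simps one_in)

lemma inv_lex: "\<lbrakk>h \<in> H; g \<in> carrier G\<rbrakk> \<Longrightarrow> inv\<^bsub>L\<^esub> (h, g) = (- h, inv g)"
  by (rule L.inv_equality) (simp_all add: lex_simps uminus_in)

lemma meet_lex:
  "\<lbrakk>h \<in> H; g \<in> carrier G; h' \<in> H; g' \<in> carrier G\<rbrakk> \<Longrightarrow> L.meet (h, g) (h', g') =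
    (if h < h' then (h, g) else if h' < h then (h', g') else (h, meet g g'))"
  by (rule L.meetI) (auto simp: lex_simps grp_le_refl meet_lower meet_closed meet_greatest)

lemma Gamma_lex_simps:
  "(h, g) \<in> carrier (Gamma L (1, \<one>)) \<longleftrightarrow> h \<in> H \<and> g \<in> carrier G \<and>
    (0 < h \<and> h < 1 \<or> h = 0 \<and> grp_le G \<one> g \<or> h = 1 \<and> grp_le G g \<one>)"
  "\<lbrakk>h \<in> H; g \<in> carrier G; h' \<in> H; g' \<in> carrier G\<rbrakk> \<Longrightarrow> (h, g) \<oplus>\<^bsub>Gamma L (1, \<one>)\<^esub> (h', g') =
    (if h + h' < 1 then (h + h', g \<otimes> g') else if 1 < h + h' then (1, \<one>)
     else (1, meet (g \<otimes> g') \<one>))"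
  "\<lbrakk>h \<in> H; g \<in> carrier G\<rbrakk> \<Longrightarrow> lneg (Gamma L (1, \<one>)) (h, g) = (1 - h, inv g)"
  "\<lbrakk>h \<in> H; g \<in> carrier G\<rbrakk> \<Longrightarrow> rneg (Gamma L (1, \<one>)) (h, g) = (1 - h, inv g)"
  "pmv_zero (Gamma L (1, \<one>)) = (0, \<one>)"
  "pmv_one (Gamma L (1, \<one>)) = (1, \<one>)"
  by (auto simp: L.Gamma_simps lex_simps meet_lex plus_in one_in inv_lex)

lemma pow_lex: "(1, \<one>) [^]\<^bsub>L\<^esub> n = (of_nat n, \<one>)"
  by (induction n) (simp_all add: lex_simps)

end

lemma (in lex_l_group) unital_lex:
  assumes arch: "\<And>h. h \<in> H \<Longrightarrow> \<exists>n. h < of_nat n"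
  shows "unital_l_group L (1, \<one>)"
proof -
  have "\<exists>n::nat. grp_le L (inv\<^bsub>L\<^esub> ((1, \<one>) [^]\<^bsub>L\<^esub> n)) x \<and> grp_le L x ((1, \<one>) [^]\<^bsub>L\<^esub> n)"
    if "x \<in> carrier L" for x
  proof -
    from that obtain h g where x: "x = (h, g)" "h \<in> H" "g \<in> carrier G"
      by (cases x) (auto simp: lex_simps)
    \<comment> \<open>The bounds must be strict: with equal first coordinates the lexicographic
      order would still compare \<open>g\<close> with \<open>\<one>\<close>. The sum
      \<open>n + m\<close> serves both sides at once.\<close>
    obtain n m where nm: "h < of_nat n" "- h < of_nat m" using arch x uminus_in by meson
    have "of_nat n \<le> (of_nat (n + m) :: 'a)" "of_nat m \<le> (of_nat (n + m) :: 'a)"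
      by (simp_all only: of_nat_le_iff)
    then have lt: "h < of_nat (n + m)" "- of_nat (n + m) < h"
      using nm by linarith+
    show ?thesis
      using x lt by (intro exI[of _ "n + m"])
        (auto simp only: pow_lex inv_lex of_nat_in lex_simps one_closed)
  qed
  then show ?thesis
    by (auto simp: unital_l_group_def l_group_lex L.u_closed L.one_le_u)
qed

text \<open>\<open>s\<close> plays the role of the projection onto the first factor of a lexicographic product;
  its kernel cuts out the only maximal ideal.\<close>

lemma (in l_group_interval) in_symmetric_variety_Gamma:
  fixes s :: "'a \<Rightarrow> real"
  assumes central: "\<And>x. x \<in> carrier G \<Longrightarrow> x \<otimes> u = u \<otimes> x"
    and s_mult: "\<And>x y. \<lbrakk>x \<in> carrier G; y \<in> carrier G\<rbrakk> \<Longrightarrow> s (x \<otimes> y) = s x + s y"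
    and s_nonneg: "\<And>x. \<lbrakk>x \<in> carrier G; grp_le G \<one> x\<rbrakk> \<Longrightarrow> 0 \<le> s x"
    and s_pos: "\<And>x. \<lbrakk>x \<in> carrier G; 0 < s x\<rbrakk> \<Longrightarrow> grp_le G \<one> x"
    and s_u: "s u = 1"
  shows "in_symmetric_variety (Gamma G u)"
proof -
  let ?\<Gamma> = "Gamma G u"
  interpret \<Gamma>: pseudo_MV ?\<Gamma> by (rule pseudo_MV_Gamma)
  have s_one: "s \<one> = 0" using s_mult[of \<one> \<one>] by simp
  have s_inv: "s (inv x) = - s x" if "x \<in> carrier G" for x
    using s_mult[of x "inv x"] that s_one by simp
  have s_mono: "s x \<le> s y" if "grp_le G x y" "x \<in> carrier G" "y \<in> carrier G" for x y
    using s_nonneg[of "inv x \<otimes> y"] that grp_le_left_mult_iff(1)[of \<one> y x] s_mult s_inv by simp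
  have le_of_s: "grp_le G x y" if "s x < s y" "x \<in> carrier G" "y \<in> carrier G" for x y
    using s_pos[of "inv x \<otimes> y"] that grp_le_left_mult_iff(1)[of \<one> y x] s_mult s_inv by simp
  define R where "R = {x \<in> carrier ?\<Gamma>. s x = 0}"
  have R_I: "x \<in> R" if "x \<in> carrier G" "grp_le G \<one> x" "s x = 0" for x
    using that le_of_s[of x u] u_closed s_u by (simp add: R_def Gamma_simps)
  have R_oplus: "x \<oplus>\<^bsub>?\<Gamma>\<^esub> y = x \<otimes> y" "x \<otimes> y \<in> R" if "x \<in> R" "y \<in> R" for x y
  proof -
    have c: "x \<in> carrier G" "y \<in> carrier G" "grp_le G \<one> x" "grp_le G \<one> y" "s x = 0" "s y = 0"
      using that by (auto simp: R_def Gamma_simps)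
    then show "x \<otimes> y \<in> R" by (intro R_I) (simp_all add: one_le_mult s_mult)
    show "x \<oplus>\<^bsub>?\<Gamma>\<^esub> y = x \<otimes> y"
      using c le_of_s[of "x \<otimes> y" u] u_closed s_u s_mult by (simp add: Gamma_simps meet_absorb)
  qed
  have R_ideal: "pmv_ideal ?\<Gamma> R"
  proof -
    have "x \<in> R" if "x \<in> carrier ?\<Gamma>" "y \<in> R" "pmv_le ?\<Gamma> x y" for x y
      using that pmv_le_Gamma[of x y] s_mono[of x y] s_nonneg[of x]
      by (auto simp: R_def Gamma_simps)
    moreover have "x \<oplus>\<^bsub>?\<Gamma>\<^esub> y \<in> R" if "x \<in> R" "y \<in> R" for x y
      using R_oplus[OF that] by simp
    moreover have "\<one> \<in> R" by (intro R_I) (simp_all add: grp_le_refl s_one)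
    moreover have "R \<subseteq> carrier ?\<Gamma>" by (auto simp: R_def)
    ultimately show ?thesis unfolding pmv_ideal_def by blast
  qed
  have u_in: "u \<in> carrier ?\<Gamma>" using \<Gamma>.unit_closed by (simp add: Gamma_simps(6))
  have R_ne: "R \<noteq> carrier ?\<Gamma>"
  proof
    assume "R = carrier ?\<Gamma>"
    then have "u \<in> R" using u_in by simp
    then show False using s_u by (simp add: R_def)
  qed
  have maximal_eq: "J = R" if J: "pmv_maximal_ideal ?\<Gamma> J" for J
  proof -
    have J_ideal: "pmv_ideal ?\<Gamma> J" and J_ne: "J \<noteq> carrier ?\<Gamma>"
      using J by (auto simp: pmv_maximal_ideal_def)
    have J_sub: "J \<subseteq> carrier ?\<Gamma>"
      and J_down: "\<And>x y. \<lbrakk>x \<in> carrier ?\<Gamma>; y \<in> J; grp_le G x y\<rbrakk> \<Longrightarrow> x \<in> J"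
      and J_oplus: "\<And>x y. \<lbrakk>x \<in> J; y \<in> J\<rbrakk> \<Longrightarrow> x \<oplus>\<^bsub>?\<Gamma>\<^esub> y \<in> J"
      using J_ideal pmv_le_Gamma unfolding pmv_ideal_def by (blast, blast, blast)
    have "s x = 0" if x: "x \<in> J" for x
    proof (rule ccontr)
      have c: "x \<in> carrier G" "grp_le G \<one> x" "x \<in> carrier ?\<Gamma>"
        using x J_sub by (auto simp: Gamma_simps)
      assume "s x \<noteq> 0"
      then have pos: "0 < s x" using s_nonneg c by force
      \<comment> \<open>\<open>J\<close> contains all truncated multiples of \<open>x\<close>. As
        \<open>s x\<close> is positive, some multiple has \<open>s\<close>-value above
        \<open>s u = 1\<close> and so exceeds \<open>u\<close>, which puts \<open>u\<close> into
        \<open>J\<close> and makes \<open>J\<close> improper.\<close>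
      have in_J: "meet (x [^] n) u \<in> J" for n :: nat
      proof (induction n)
        case 0
        have "\<one> \<in> J"
          using J_down[of \<one> x] x c \<Gamma>.zero_closed by (simp add: Gamma_simps)
        then show ?case using one_le_u u_closed by (simp add: meet_absorb)
      next
        case (Suc n)
        have "meet (x [^] n) u \<oplus>\<^bsub>?\<Gamma>\<^esub> x = meet (x [^] Suc n) u"
          using c by (simp add: Gamma_simps meet_meet_u)
        then show ?case using J_oplus[OF Suc x] by simp
      qed
      obtain n :: nat where n: "1 < real n * s x"
        using reals_Archimedean3[OF pos] by blast
      have "s (x [^] n) = real n * s x"
        using c by (induction n) (simp_all add: s_one s_mult algebra_simps)
      then have "grp_le G u (x [^] n)"
        using le_of_s[of u "x [^] n"] c u_closed s_u n by simp
      then have "u \<in> J"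
        using in_J[of n] c u_closed by (simp add: meet_absorb)
      then have "J = carrier ?\<Gamma>"
        using J_down J_sub by (auto simp: Gamma_simps)
      then show False using J_ne by simp
    qed
    then have "J \<subseteq> R" using J_sub by (auto simp: R_def)
    \<comment> \<open>\<open>J\<close> lies inside the proper ideal \<open>R\<close>, so its own
      maximality forces equality.\<close>
    then show ?thesis using J R_ideal R_ne by (auto simp: pmv_maximal_ideal_def)
  qed
  have conj: "\<exists>k\<in>R. x \<oplus>\<^bsub>?\<Gamma>\<^esub> i = k \<oplus>\<^bsub>?\<Gamma>\<^esub> x" "\<exists>k\<in>R. i \<oplus>\<^bsub>?\<Gamma>\<^esub> x = x \<oplus>\<^bsub>?\<Gamma>\<^esub> k"
    if "x \<in> carrier ?\<Gamma>" "i \<in> R" for x i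
  proof -
    have c: "x \<in> carrier G" "i \<in> carrier G" "grp_le G \<one> i" "s i = 0"
      using that by (auto simp: R_def Gamma_simps)
    \<comment> \<open>Conjugation preserves positivity, and \<open>s\<close> does not see it because
      its values are added in the commutative group of reals.\<close>
    have R: "x \<otimes> i \<otimes> inv x \<in> R" "inv x \<otimes> i \<otimes> x \<in> R"
    proof -
      have "grp_le G \<one> (x \<otimes> i \<otimes> inv x)"
        using c grp_le_right_mult_iff(1)[of \<one> "x \<otimes> i" x] grp_le_mult_left_iff[of \<one> i x] by simp
      then show "x \<otimes> i \<otimes> inv x \<in> R"
        using c by (intro R_I) (simp_all add: s_mult s_inv)
      have "grp_le G \<one> (inv x \<otimes> (i \<otimes> x))"
        using c grp_le_left_mult_iff(1)[of \<one> "i \<otimes> x" x] grp_le_mult_right_iff[of \<one> i x] by simp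
      then show "inv x \<otimes> i \<otimes> x \<in> R"
        using c by (intro R_I) (simp_all add: s_mult s_inv m_assoc)
    qed
    then show "\<exists>k\<in>R. x \<oplus>\<^bsub>?\<Gamma>\<^esub> i = k \<oplus>\<^bsub>?\<Gamma>\<^esub> x"
      using c by (intro bexI[of _ "x \<otimes> i \<otimes> inv x"]) (simp_all add: Gamma_simps m_assoc)
    show "\<exists>k\<in>R. i \<oplus>\<^bsub>?\<Gamma>\<^esub> x = x \<oplus>\<^bsub>?\<Gamma>\<^esub> k"
      using c R by (intro bexI[of _ "inv x \<otimes> i \<otimes> x"]) (simp_all add: Gamma_simps m_assoc inv_cancel_left)
  qed
  have "pmv_normal_ideal ?\<Gamma> R"
    unfolding pmv_normal_ideal_def using R_ideal conj by (auto simp: image_iff)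
  then show ?thesis
    using maximal_eq pseudo_MV_Gamma central
    by (auto simp: in_symmetric_variety_def in_class_M_def pmv_symmetric_def Gamma_simps
        u_closed m_assoc inv_solve_left inv_solve_right)
qed

text \<open>The isomorphic copy of \<open>G\<close> on the image of \<open>j\<close>. It serves to
  place the lexicographic product, which lives on a type of pairs, in the type over which weak free
  products are tested.\<close>

definition transport_group :: "('a \<Rightarrow> 'b) \<Rightarrow> 'a ordered_group \<Rightarrow> 'b ordered_group"
  where "transport_group j G = \<lparr>
    carrier = j ` carrier G,
    mult = (\<lambda>x y. j (inv_into (carrier G) j x \<otimes>\<^bsub>G\<^esub> inv_into (carrier G) j y)),
    one = j \<one>\<^bsub>G\<^esub>,
    grp_le = (\<lambda>x y. grp_le G (inv_into (carrier G) j x) (inv_into (carrier G) j y))\<rparr>"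

locale l_group_transport = l_group_interval +
  fixes j :: "'a \<Rightarrow> 'b"
  assumes inj: "inj_on j (carrier G)"
begin

abbreviation "T \<equiv> transport_group j G"

lemma transport_simps:
  "carrier T = j ` carrier G"
  "\<one>\<^bsub>T\<^esub> = j \<one>"
  "\<lbrakk>x \<in> carrier G; y \<in> carrier G\<rbrakk> \<Longrightarrow> j x \<otimes>\<^bsub>T\<^esub> j y = j (x \<otimes> y)"
  "\<lbrakk>x \<in> carrier G; y \<in> carrier G\<rbrakk> \<Longrightarrow> grp_le T (j x) (j y) \<longleftrightarrow> grp_le G x y"
  using inj by (simp_all add: transport_group_def)

lemma l_group_T: "l_group T"
proof (rule l_groupI)
  show "group T"
  proof (rule groupI)
    fix x assume "x \<in> carrier T"
    then obtain g where "g \<in> carrier G" "x = j g" by (auto simp: transport_simps)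
    then show "\<exists>y\<in>carrier T. y \<otimes>\<^bsub>T\<^esub> x = \<one>\<^bsub>T\<^esub>"
      by (intro bexI[of _ "j (inv g)"]) (auto simp: transport_simps)
  qed (auto simp: transport_simps m_assoc)
  fix x y assume "x \<in> carrier T" "y \<in> carrier T"
  then obtain g h where "g \<in> carrier G" "x = j g" "h \<in> carrier G" "y = j h"
    by (auto simp: transport_simps)
  then show "\<exists>z\<in>carrier T. grp_le T z x \<and> grp_le T z y \<and>
      (\<forall>l\<in>carrier T. grp_le T l x \<longrightarrow> grp_le T l y \<longrightarrow> grp_le T l z)"
    by (intro bexI[of _ "j (meet g h)"])
       (auto simp: transport_simps meet_closed meet_lower meet_greatest)
next
  fix x y z assume "x \<in> carrier T" "y \<in> carrier T" "z \<in> carrier T" "grp_le T x y" "grp_le T y z"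
  then show "grp_le T x z" by (auto simp: transport_simps intro: grp_le_trans)
qed (auto simp: transport_simps grp_le_refl intro: le_mult_left le_mult_right
    arg_cong[of _ _ j, OF grp_le_antisym])

sublocale T: l_group_interval T "j u"
  by (intro l_group_interval.intro l_group_T l_group_interval_axioms.intro)
     (simp_all add: transport_simps u_closed one_le_u)

lemma inv_transport: "x \<in> carrier G \<Longrightarrow> inv\<^bsub>T\<^esub> j x = j (inv x)"
  by (rule T.inv_equality) (auto simp: transport_simps)

lemma meet_transport: "\<lbrakk>x \<in> carrier G; y \<in> carrier G\<rbrakk> \<Longrightarrow> T.meet (j x) (j y) = j (meet x y)"
  by (rule T.meetI) (auto simp: transport_simps meet_closed meet_lower meet_greatest)

lemma transport_iso: "j \<in> pmv_iso (Gamma G u) (Gamma T (j u))"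
proof -
  have "j ` carrier (Gamma G u) = carrier (Gamma T (j u))"
    using u_closed by (auto simp: Gamma_simps T.Gamma_simps transport_simps)
  moreover have "inj_on j (carrier (Gamma G u))"
    using inj by (rule inj_on_subset) (auto simp: Gamma_simps)
  ultimately have "bij_betw j (carrier (Gamma G u)) (carrier (Gamma T (j u)))"
    by (simp add: bij_betw_def)
  moreover have "j \<in> pmv_hom (Gamma G u) (Gamma T (j u))"
    using u_closed by (auto simp: pmv_hom_def Gamma_simps T.Gamma_simps transport_simps
        meet_transport inv_transport)
  ultimately show ?thesis by (simp add: pmv_iso_def)
qed

lemma unital_transport:
  assumes "unital_l_group G u" shows "unital_l_group T (j u)"
proof -
  have "j u [^]\<^bsub>T\<^esub> n = j (u [^] n)" for n :: nat
    using u_closed by (induction n) (simp_all add: transport_simps)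
  then show ?thesis
    using assms T.u_closed T.one_le_u u_closed
    by (auto simp: unital_l_group_def l_group_T transport_simps inv_transport)
qed

end

section \<open>Extension of homomorphisms\<close>

locale Gamma_hom = A: l_group_interval A u + W: l_group_interval W w
  for A :: "'a ordered_group" and u and W :: "'w ordered_group" and w +
  fixes f
  assumes hom: "f \<in> pmv_hom (Gamma A u) (Gamma W w)"
begin

interpretation A': pseudo_MV "Gamma A u" by (rule A.pseudo_MV_Gamma)

lemma closed: "x \<in> carrier (Gamma A u) \<Longrightarrow> f x \<in> carrier (Gamma W w)"
  using hom by (auto simp: pmv_hom_def)

lemma closed':
  assumes "x \<in> carrier (Gamma A u)"
  shows "f x \<in> carrier W" "grp_le W \<one>\<^bsub>W\<^esub> (f x)" "grp_le W (f x) w"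
  using closed[OF assms] by (auto simp: W.Gamma_simps)

lemma hom_one: "f \<one>\<^bsub>A\<^esub> = \<one>\<^bsub>W\<^esub>" and hom_unit: "f u = w"
  using hom by (simp_all add: pmv_hom_def A.Gamma_simps W.Gamma_simps)

lemma hom_oplus:
  "\<lbrakk>x \<in> carrier (Gamma A u); y \<in> carrier (Gamma A u)\<rbrakk> \<Longrightarrow>
    f (x \<oplus>\<^bsub>Gamma A u\<^esub> y) = f x \<oplus>\<^bsub>Gamma W w\<^esub> f y"
  and hom_lneg: "x \<in> carrier (Gamma A u) \<Longrightarrow> f (lneg (Gamma A u) x) = lneg (Gamma W w) (f x)"
  and hom_rneg: "x \<in> carrier (Gamma A u) \<Longrightarrow> f (rneg (Gamma A u) x) = rneg (Gamma W w) (f x)"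
  using hom by (auto simp: pmv_hom_def)

text \<open>By A7 the lattice meet is a term in the operations, hence preserved.\<close>

lemma hom_meet:
  assumes "x \<in> carrier (Gamma A u)" "y \<in> carrier (Gamma A u)"
  shows "f (A.meet x y) = W.meet (f x) (f y)"
proof -
  have "f (x \<odot>\<^bsub>Gamma A u\<^esub> (lneg (Gamma A u) x \<oplus>\<^bsub>Gamma A u\<^esub> y)) =
      f x \<odot>\<^bsub>Gamma W w\<^esub> (lneg (Gamma W w) (f x) \<oplus>\<^bsub>Gamma W w\<^esub> f y)"
    using assms
    by (simp add: otimes_def hom_oplus hom_lneg hom_rneg A'.oplus_closed A'.lneg_closed)
  then show ?thesis
    using assms closed by (simp add: A.Gamma_meet W.Gamma_meet)
qed

lemma hom_mono:
  assumes "grp_le A x y" "x \<in> carrier (Gamma A u)" "y \<in> carrier (Gamma A u)"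
  shows "grp_le W (f x) (f y)"
proof -
  have "A.meet x y = x" using assms by (simp add: A.meet_absorb A.Gamma_simps)
  then have "f x = W.meet (f x) (f y)" using hom_meet[OF assms(2,3)] by simp
  then show ?thesis using W.meet_lower(2)[of "f x" "f y"] closed' assms by simp
qed

text \<open>That the sum stays below \<open>u\<close> can be said inside the algebra, as
  \<open>x\<close> being below the negation of \<open>y\<close>. A homomorphism preserves this, so
  neither truncated sum is actually cut off.\<close>

lemma hom_mult:
  assumes "grp_le A (x \<otimes>\<^bsub>A\<^esub> y) u" "x \<in> carrier (Gamma A u)" "y \<in> carrier (Gamma A u)"
  shows "f (x \<otimes>\<^bsub>A\<^esub> y) = f x \<otimes>\<^bsub>W\<^esub> f y"
proof -
  have c: "x \<in> carrier A" "y \<in> carrier A" using assms by (auto simp: A.Gamma_simps)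
  have "grp_le A x (lneg (Gamma A u) y)"
    using assms(1) c A.u_closed by (simp add: A.Gamma_simps flip: A.grp_le_right_mult_iff)
  then have "grp_le W (f x) (lneg (Gamma W w) (f y))"
    using hom_mono[of x "lneg (Gamma A u) y"] assms by (simp add: hom_lneg A'.lneg_closed)
  then have "grp_le W (f x \<otimes>\<^bsub>W\<^esub> f y) w"
    using closed' assms W.u_closed by (simp add: W.Gamma_simps flip: W.grp_le_right_mult_iff)
  moreover have "f (x \<otimes>\<^bsub>A\<^esub> y) = f x \<oplus>\<^bsub>Gamma W w\<^esub> f y"
    using hom_oplus[OF assms(2,3)] assms(1) c A.u_closed by (simp add: A.Gamma_simps A.meet_absorb)
  ultimately show ?thesis
    using closed' assms W.u_closed by (simp add: W.Gamma_simps W.meet_absorb)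
qed

end

text \<open>Homomorphisms of positive cones extend to the groups of differences. No commutativity is
  needed because the cone is invariant under conjugation, which provides common multiples.\<close>

locale cone_hom = G: l_group G + W: l_group W
  for G :: "'g ordered_group" (structure) and W :: "'w ordered_group" +
  fixes p :: "'g \<Rightarrow> 'w"
  assumes p_closed: "\<And>a. \<lbrakk>a \<in> carrier G; grp_le G \<one> a\<rbrakk> \<Longrightarrow> p a \<in> carrier W"
    and p_pos: "\<And>a. \<lbrakk>a \<in> carrier G; grp_le G \<one> a\<rbrakk> \<Longrightarrow> grp_le W \<one>\<^bsub>W\<^esub> (p a)"
    and p_one: "p \<one> = \<one>\<^bsub>W\<^esub>"
    and p_mult: "\<And>a b. \<lbrakk>a \<in> carrier G; b \<in> carrier G; grp_le G \<one> a; grp_le G \<one> b\<rbrakk>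
      \<Longrightarrow> p (a \<otimes> b) = p a \<otimes>\<^bsub>W\<^esub> p b"
    and p_meet: "\<And>a b. \<lbrakk>a \<in> carrier G; b \<in> carrier G; grp_le G \<one> a; grp_le G \<one> b\<rbrakk>
      \<Longrightarrow> p (G.meet a b) = W.meet (p a) (p b)"
begin

definition cone where "cone = {a \<in> carrier G. grp_le G \<one> a}"

lemma cone_carrier: "a \<in> cone \<Longrightarrow> a \<in> carrier G"
  by (simp add: cone_def)

lemma cone_mult: "\<lbrakk>a \<in> cone; b \<in> cone\<rbrakk> \<Longrightarrow> a \<otimes> b \<in> cone"
  by (simp add: cone_def G.one_le_mult)

lemma cone_conj:
  assumes "a \<in> cone" "x \<in> carrier G" shows "inv x \<otimes> (a \<otimes> x) \<in> cone"
proof -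
  have "grp_le G (\<one> \<otimes> x) (a \<otimes> x)"
    using assms by (subst G.grp_le_mult_right_iff) (auto simp: cone_def)
  then show ?thesis
    using assms by (simp add: cone_def flip: G.grp_le_left_mult_iff)
qed

lemma p_cone:
  "a \<in> cone \<Longrightarrow> p a \<in> carrier W" "a \<in> cone \<Longrightarrow> grp_le W \<one>\<^bsub>W\<^esub> (p a)"
  "\<lbrakk>a \<in> cone; b \<in> cone\<rbrakk> \<Longrightarrow> p (a \<otimes> b) = p a \<otimes>\<^bsub>W\<^esub> p b"
  "\<lbrakk>a \<in> cone; b \<in> cone\<rbrakk> \<Longrightarrow> p (G.meet a b) = W.meet (p a) (p b)"
  by (simp_all add: cone_def p_closed p_pos p_mult p_meet)

text \<open>\<open>inv x\<close> need not lie in the cone, so \<open>p\<close> is applied to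
  \<open>x \<otimes> (inv x \<otimes> (a \<otimes> x)) = a \<otimes> x\<close>, where all factors
  do, and \<open>p x\<close> is cancelled in \<open>W\<close>.\<close>

lemma p_conj:
  assumes "a \<in> cone" "x \<in> cone"
  shows "p (inv x \<otimes> (a \<otimes> x)) = inv\<^bsub>W\<^esub> p x \<otimes>\<^bsub>W\<^esub> (p a \<otimes>\<^bsub>W\<^esub> p x)"
proof -
  have "p x \<otimes>\<^bsub>W\<^esub> p (inv x \<otimes> (a \<otimes> x)) = p a \<otimes>\<^bsub>W\<^esub> p x"
    using assms by (simp add: cone_conj cone_carrier G.inv_cancel_left flip: p_cone(3))
  then show ?thesis
    using assms cone_conj cone_carrier p_cone(1) by (metis W.inv_cancel_left(1))
qed

lemma difference:
  assumes "g \<in> carrier G"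
  obtains a b where "a \<in> cone" "b \<in> cone" "g = a \<otimes> inv b"
    "a = g \<otimes> inv (G.meet g \<one>)" "b = inv (G.meet g \<one>)"
  using G.difference[OF assms] by (metis (mono_tags, lifting) cone_def mem_Collect_eq)

text \<open>Additively, the value of \<open>p\<close> at the positive part of \<open>g\<close> minus
  its value at the negative part; \<open>ext_eq\<close> frees it from this particular
  decomposition.\<close>

definition ext where
  "ext g = p (g \<otimes> inv (G.meet g \<one>)) \<otimes>\<^bsub>W\<^esub> inv\<^bsub>W\<^esub> p (inv (G.meet g \<one>))"

text \<open>Clearing denominators gives \<open>a \<otimes> d = c \<otimes> (inv d \<otimes> (b
  \<otimes> d))\<close>. Conjugating \<open>b\<close> keeps it in the cone, so this is an equation
  between products of cone elements and \<open>p\<close> can be applied.\<close>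

lemma difference_unique:
  assumes c: "a \<in> cone" "b \<in> cone" "c \<in> cone" "d \<in> cone" and eq: "a \<otimes> inv b = c \<otimes> inv d"
  shows "p a \<otimes>\<^bsub>W\<^esub> inv\<^bsub>W\<^esub> p b = p c \<otimes>\<^bsub>W\<^esub> inv\<^bsub>W\<^esub> p d"
proof -
  note c' = c[THEN cone_carrier] and pc = c[THEN p_cone(1)]
  have "a = c \<otimes> inv d \<otimes> b"
    using c' by (simp add: G.m_assoc flip: eq)
  then have "a \<otimes> d = c \<otimes> (inv d \<otimes> (b \<otimes> d))"
    using c' by (simp add: G.m_assoc)
  then have "p a \<otimes>\<^bsub>W\<^esub> p d = p c \<otimes>\<^bsub>W\<^esub> (inv\<^bsub>W\<^esub> p d \<otimes>\<^bsub>W\<^esub> (p b \<otimes>\<^bsub>W\<^esub> p d))"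
    using c by (metis p_cone(3) p_conj cone_conj cone_carrier)
  then have "p a = p c \<otimes>\<^bsub>W\<^esub> inv\<^bsub>W\<^esub> p d \<otimes>\<^bsub>W\<^esub> p b"
    using pc W.right_cancel[of "p d" "p a" "p c \<otimes>\<^bsub>W\<^esub> inv\<^bsub>W\<^esub> p d \<otimes>\<^bsub>W\<^esub> p b"]
    by (simp add: W.m_assoc)
  then show ?thesis using pc by (simp add: W.m_assoc)
qed

lemma ext_eq:
  assumes "a \<in> cone" "b \<in> cone"
  shows "ext (a \<otimes> inv b) = p a \<otimes>\<^bsub>W\<^esub> inv\<^bsub>W\<^esub> p b"
proof -
  obtain c d where "c \<in> cone" "d \<in> cone" "a \<otimes> inv b = c \<otimes> inv d"
    "ext (a \<otimes> inv b) = p c \<otimes>\<^bsub>W\<^esub> inv\<^bsub>W\<^esub> p d"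
    unfolding ext_def using difference[of "a \<otimes> inv b"] assms cone_carrier
    by (metis G.inv_closed G.m_closed)
  then show ?thesis using difference_unique assms by metis
qed

lemma ext_closed: "g \<in> carrier G \<Longrightarrow> ext g \<in> carrier W"
  using difference[of g] ext_eq p_cone(1) by (metis W.inv_closed W.m_closed)

lemma one_cone: "\<one> \<in> cone"
  by (simp add: cone_def G.grp_le_refl)

lemma ext_cone: "a \<in> cone \<Longrightarrow> ext a = p a"
  using ext_eq[of a \<one>] by (simp add: one_cone cone_carrier p_one p_cone)

lemma ext_mult:
  assumes "g \<in> carrier G" "h \<in> carrier G"
  shows "ext (g \<otimes> h) = ext g \<otimes>\<^bsub>W\<^esub> ext h"
proof -
  obtain a b where ab: "a \<in> cone" "b \<in> cone" "g = a \<otimes> inv b" using difference[OF assms(1)] .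
  obtain c d where cd: "c \<in> cone" "d \<in> cone" "h = c \<otimes> inv d" using difference[OF assms(2)] .
  \<comment> \<open>Chosen so that \<open>inv b \<otimes> c = c \<otimes> inv ?f\<close>: the
    denominator of \<open>g\<close> moves to the right of the numerator of \<open>h\<close>, and the
    product becomes a single difference of cone elements.\<close>
  let ?f = "inv c \<otimes> (b \<otimes> c)"
  have f: "?f \<in> cone" using ab cd by (simp add: cone_conj cone_carrier)
  note c' = ab(1,2)[THEN cone_carrier] cd(1,2)[THEN cone_carrier]
    and pc = ab(1,2)[THEN p_cone(1)] cd(1,2)[THEN p_cone(1)]
  have "g \<otimes> h = (a \<otimes> c) \<otimes> inv (d \<otimes> ?f)"
    using c' ab(3) cd(3) by (simp add: G.m_assoc G.inv_mult_group G.inv_cancel_left)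
  then have "ext (g \<otimes> h) = p (a \<otimes> c) \<otimes>\<^bsub>W\<^esub> inv\<^bsub>W\<^esub> p (d \<otimes> ?f)"
    using ab cd f by (simp only: ext_eq cone_mult)
  also have "\<dots> = (p a \<otimes>\<^bsub>W\<^esub> p c) \<otimes>\<^bsub>W\<^esub>
      inv\<^bsub>W\<^esub> (p d \<otimes>\<^bsub>W\<^esub> (inv\<^bsub>W\<^esub> p c \<otimes>\<^bsub>W\<^esub> (p b \<otimes>\<^bsub>W\<^esub> p c)))"
    using ab cd f by (simp only: p_cone(3) p_conj)
  also have "\<dots> = (p a \<otimes>\<^bsub>W\<^esub> inv\<^bsub>W\<^esub> p b) \<otimes>\<^bsub>W\<^esub> (p c \<otimes>\<^bsub>W\<^esub> inv\<^bsub>W\<^esub> p d)"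
    using pc by (simp add: W.m_assoc W.inv_mult_group W.inv_cancel_left)
  also have "\<dots> = ext g \<otimes>\<^bsub>W\<^esub> ext h" using ab cd by (simp add: ext_eq)
  finally show ?thesis .
qed

lemma ext_one: "ext \<one> = \<one>\<^bsub>W\<^esub>"
  by (simp add: ext_cone one_cone p_one)

lemma ext_inv:
  assumes "g \<in> carrier G" shows "ext (inv g) = inv\<^bsub>W\<^esub> ext g"
  using ext_mult[of "inv g" g] assms by (simp add: ext_one ext_closed W.inv_equality)

text \<open>A common denominator turns the meet into \<open>meet a b\<close> times
  \<open>inv b\<close>, and \<open>p\<close> preserves meets in the cone. This shape of meet is the
  one that truncation produces in a lexicographic interval when the first coordinates add up to
  1.\<close>

lemma ext_meet_one:
  assumes "g \<in> carrier G"
  shows "ext (G.meet g \<one>) = W.meet (ext g) \<one>\<^bsub>W\<^esub>"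
proof -
  obtain a b where ab: "a \<in> cone" "b \<in> cone" "g = a \<otimes> inv b" using difference[OF assms] .
  note c' = ab(1,2)[THEN cone_carrier] and pc = ab(1,2)[THEN p_cone(1)]
  have "G.meet a b \<in> cone"
    using ab G.meet_greatest[of \<one> a b] by (simp add: cone_def G.meet_closed)
  moreover have "G.meet g \<one> = G.meet a b \<otimes> inv b"
    using c' ab(3) by (simp add: G.mult_meet_right)
  ultimately have "ext (G.meet g \<one>) = W.meet (p a) (p b) \<otimes>\<^bsub>W\<^esub> inv\<^bsub>W\<^esub> p b"
    using ab by (simp add: ext_eq p_cone)
  then show ?thesis
    using ab pc by (simp add: ext_eq W.mult_meet_right)
qed

text \<open>Dropping the subtracted positive element \<open>p b\<close> can only increase the value.
  This reduces bounds for arbitrary \<open>g\<close> to bounds on the cone.\<close>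

lemma ext_bounded:
  assumes "g \<in> carrier G" shows "\<exists>a\<in>cone. grp_le W (ext g) (p a)"
proof -
  obtain a b where ab: "a \<in> cone" "b \<in> cone" "g = a \<otimes> inv b" using difference[OF assms] .
  then have "grp_le W (ext g) (p a)"
    using p_cone(1,2)[OF ab(2)] p_cone(1)[OF ab(1)] W.grp_le_right_mult_iff(2)[of "p a" "p a" "p b"]
      W.grp_le_mult_left_iff[of "\<one>\<^bsub>W\<^esub>" "p b" "p a"]
    by (simp add: ext_eq)
  then show ?thesis using ab by blast
qed

end

lemma ordered_subgroup_int: "ordered_subgroup (UNIV :: int set)"
proof (rule ordered_subgroup.intro)
  have "group (additive_group (UNIV :: int set))"
    by (rule groupI) (auto simp: additive_group_def add.assoc intro: exI[of _ "- _"])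
  then show "subgroup (UNIV :: int set) (additive_group UNIV)"
    using group.subgroup_self[of "additive_group (UNIV :: int set)"] by (simp add: additive_group_def)
qed simp

text \<open>Provides, for the same \<open>G\<close>, the integer lexicographic product that models
  the generated subalgebra.\<close>

sublocale lex_l_group \<subseteq> Z: lex_l_group "UNIV :: int set" G
  by (intro lex_l_group.intro ordered_subgroup_int l_group_axioms)

section \<open>Commuting pairs of homomorphisms\<close>

locale commuting_pair = lex_l_group H G + W: l_group_interval W w
  for H :: "real set" and G :: "'g ordered_group" (structure) and W :: "'w ordered_group" and w +
  fixes \<kappa>\<^sub>1 \<kappa>\<^sub>2
  assumes hom1: "\<kappa>\<^sub>1 \<in> pmv_hom (Gamma (additive_group H) 1) (Gamma W w)"
    and hom2: "\<kappa>\<^sub>2 \<in> pmv_hom (Gamma Z.L (1, \<one>)) (Gamma W w)"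
    and commuting: "commuting_sums W (carrier (Gamma (additive_group H) 1))
      (carrier (Gamma Z.L (1, \<one>))) \<kappa>\<^sub>1 \<kappa>\<^sub>2"
begin

sublocale k1: Gamma_hom "additive_group H" 1 W w \<kappa>\<^sub>1
  by unfold_locales (rule hom1)

sublocale k2: Gamma_hom Z.L "(1, \<one>)" W w \<kappa>\<^sub>2
  by unfold_locales (rule hom2)

definition p where "p g = \<kappa>\<^sub>2 (0, g)"

lemma cone_Gamma: "\<lbrakk>g \<in> carrier G; grp_le G \<one> g\<rbrakk> \<Longrightarrow> (0, g) \<in> carrier (Gamma Z.L (1, \<one>))"
  by (simp add: Z.Gamma_lex_simps)

sublocale K: cone_hom G W p
proof
  fix a b assume c: "a \<in> carrier G" "grp_le G \<one> a"
  show "p a \<in> carrier W" "grp_le W \<one>\<^bsub>W\<^esub> (p a)"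
    using k2.closed'[OF cone_Gamma[OF c]] by (simp_all add: p_def)
  assume d: "b \<in> carrier G" "grp_le G \<one> b"
  show "p (a \<otimes> b) = p a \<otimes>\<^bsub>W\<^esub> p b"
    using k2.hom_mult[OF _ cone_Gamma[OF c] cone_Gamma[OF d]] by (simp add: p_def lex_simps)
  show "p (meet a b) = W.meet (p a) (p b)"
    using k2.hom_meet[OF cone_Gamma[OF c] cone_Gamma[OF d]] c d by (simp add: p_def Z.meet_lex)
qed (use k2.hom_one in \<open>simp add: p_def lex_simps\<close>)

abbreviation K where "K \<equiv> K.ext"

lemma k1_closed:
  assumes "h \<in> H" "0 \<le> h" "h \<le> 1"
  shows "\<kappa>\<^sub>1 h \<in> carrier W" "grp_le W \<one>\<^bsub>W\<^esub> (\<kappa>\<^sub>1 h)" "grp_le W (\<kappa>\<^sub>1 h) w"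
  using k1.closed'[of h] assms by (simp_all add: Gamma_additive_simps)

lemma k1_plus:
  assumes "h \<in> H" "h' \<in> H" "0 \<le> h" "0 \<le> h'" "h + h' \<le> 1"
  shows "\<kappa>\<^sub>1 (h + h') = \<kappa>\<^sub>1 h \<otimes>\<^bsub>W\<^esub> \<kappa>\<^sub>1 h'"
  using k1.hom_mult[of h h'] assms by (simp add: additive_group_simps Gamma_additive_simps)

lemma k1_zero: "\<kappa>\<^sub>1 0 = \<one>\<^bsub>W\<^esub>" and k1_one: "\<kappa>\<^sub>1 1 = w"
  using k1.hom_one k1.hom_unit by (simp_all add: additive_group_simps)

lemma k1_compl:
  assumes "h \<in> H" "0 \<le> h" "h \<le> 1"
  shows "\<kappa>\<^sub>1 h \<otimes>\<^bsub>W\<^esub> \<kappa>\<^sub>1 (1 - h) = w" "\<kappa>\<^sub>1 (1 - h) \<otimes>\<^bsub>W\<^esub> \<kappa>\<^sub>1 h = w"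
  using k1_plus[of h "1 - h"] k1_plus[of "1 - h" h] assms by (simp_all add: diff_in one_in k1_one)

lemma W_commute_inv:
  "\<lbrakk>x \<otimes>\<^bsub>W\<^esub> y = y \<otimes>\<^bsub>W\<^esub> x; x \<in> carrier W; y \<in> carrier W\<rbrakk> \<Longrightarrow> x \<otimes>\<^bsub>W\<^esub> inv\<^bsub>W\<^esub> y = inv\<^bsub>W\<^esub> y \<otimes>\<^bsub>W\<^esub> x"
  by (metis W.inv_closed W.inv_cancel_left(1) W.m_assoc W.m_closed W.r_inv W.r_one)

lemma k1_p_commute:
  assumes "h \<in> H" "0 \<le> h" "h \<le> 1" "a \<in> K.cone"
  shows "\<kappa>\<^sub>1 h \<otimes>\<^bsub>W\<^esub> p a = p a \<otimes>\<^bsub>W\<^esub> \<kappa>\<^sub>1 h"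
  using commuting cone_Gamma[of a] assms
  by (auto simp: commuting_sums_def Gamma_additive_simps p_def K.cone_def)

text \<open>The hypothesis covers elements of the two intervals only. Commutation passes to inverses
  and products, and each \<open>K g\<close> is a difference of values of \<open>p\<close>.\<close>

lemma k1_K_commute:
  assumes h: "h \<in> H" "0 \<le> h" "h \<le> 1" and g: "g \<in> carrier G"
  shows "\<kappa>\<^sub>1 h \<otimes>\<^bsub>W\<^esub> K g = K g \<otimes>\<^bsub>W\<^esub> \<kappa>\<^sub>1 h"
proof -
  obtain a b where ab: "a \<in> K.cone" "b \<in> K.cone" "g = a \<otimes> inv b" using K.difference[OF g] .
  then have "\<kappa>\<^sub>1 h \<otimes>\<^bsub>W\<^esub> (p a \<otimes>\<^bsub>W\<^esub> inv\<^bsub>W\<^esub> p b) = p a \<otimes>\<^bsub>W\<^esub> (\<kappa>\<^sub>1 h \<otimes>\<^bsub>W\<^esub> inv\<^bsub>W\<^esub> p b)"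
    using k1_closed[OF h] k1_p_commute[OF h ab(1)] K.p_cone(1) by (simp flip: W.m_assoc)
  also have "\<dots> = p a \<otimes>\<^bsub>W\<^esub> (inv\<^bsub>W\<^esub> p b \<otimes>\<^bsub>W\<^esub> \<kappa>\<^sub>1 h)"
    using k1_closed[OF h] W_commute_inv[OF k1_p_commute[OF h ab(2)]] K.p_cone(1)[OF ab(2)] by simp
  finally show ?thesis
    using ab k1_closed[OF h] K.p_cone(1) by (simp add: K.ext_eq W.m_assoc)
qed

text \<open>Here \<open>H\<close> being Archimedean enters: \<open>p a\<close> is infinitesimal while \<open>\<kappa>\<^sub>1 h\<close> is not.\<close>

lemma p_le_k1:
  assumes h: "h \<in> H" "0 < h" "h \<le> 1" and a: "a \<in> K.cone"
  shows "grp_le W (p a) (\<kappa>\<^sub>1 h)"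
proof -
  have c: "\<kappa>\<^sub>1 h \<in> carrier W" "p a \<in> carrier W"
    using k1_closed[of h] h K.p_cone(1)[OF a] by simp_all
  \<comment> \<open>The homomorphism laws for \<open>\<kappa>\<^sub>1\<close> hold on the unit
    interval, so multiples of \<open>h\<close> are truncated at 1. Once \<open>real n * h\<close>
    exceeds 1, the truncated multiple is 1, whose image is \<open>w\<close>.\<close>
  have pow: "min (real n * h) 1 \<in> H \<and> grp_le W (\<kappa>\<^sub>1 (min (real n * h) 1)) (\<kappa>\<^sub>1 h [^]\<^bsub>W\<^esub> n)" for n
  proof (induction n)
    case 0
    then show ?case by (simp add: zero_in k1_zero W.grp_le_refl)
  next
    case (Suc n)
    let ?m = "min (real n * h) 1"
    have m: "?m \<in> H" "0 \<le> ?m" "?m \<le> 1" using Suc h by auto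
    have e: "min (real (Suc n) * h) 1 = min (?m + h) 1"
      using h by (auto simp: min_def algebra_simps)
    have in_H: "min (?m + h) 1 \<in> H" using m h by (simp add: min_def plus_in one_in)
    have "\<kappa>\<^sub>1 (min (?m + h) 1) = W.meet (\<kappa>\<^sub>1 ?m \<otimes>\<^bsub>W\<^esub> \<kappa>\<^sub>1 h) w"
      using k1.hom_oplus[of ?m h] m h by (simp add: Gamma_additive_simps W.Gamma_simps)
    then have "grp_le W (\<kappa>\<^sub>1 (min (?m + h) 1)) (\<kappa>\<^sub>1 ?m \<otimes>\<^bsub>W\<^esub> \<kappa>\<^sub>1 h)"
      using W.meet_lower(1)[of "\<kappa>\<^sub>1 ?m \<otimes>\<^bsub>W\<^esub> \<kappa>\<^sub>1 h" w] k1_closed(1)[OF m] c W.u_closed by simp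
    moreover have "grp_le W (\<kappa>\<^sub>1 ?m \<otimes>\<^bsub>W\<^esub> \<kappa>\<^sub>1 h) (\<kappa>\<^sub>1 h [^]\<^bsub>W\<^esub> Suc n)"
      using Suc k1_closed(1)[OF m] c by (simp add: W.grp_le_mult_right_iff)
    ultimately have "grp_le W (\<kappa>\<^sub>1 (min (?m + h) 1)) (\<kappa>\<^sub>1 h [^]\<^bsub>W\<^esub> Suc n)"
      using W.grp_le_trans[of "\<kappa>\<^sub>1 (min (?m + h) 1)" "\<kappa>\<^sub>1 ?m \<otimes>\<^bsub>W\<^esub> \<kappa>\<^sub>1 h"]
        k1_closed(1)[OF m] k1_closed(1)[OF in_H] m h c by simp
    then show ?case using in_H e by simp
  qed
  obtain n :: nat where n: "1 < real n * h"
    using reals_Archimedean3[OF h(2)] by blast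
  then have n0: "0 < n" by (cases n) auto
  have w_le: "grp_le W w (\<kappa>\<^sub>1 h [^]\<^bsub>W\<^esub> n)"
    using pow[of n] n by (simp add: k1_one min_def)
  \<comment> \<open>Multiples of \<open>(0, a)\<close> keep first coordinate 0 and thus stay in the
    interval, so no power of \<open>p a\<close> exceeds \<open>w\<close>.\<close>
  have "p a [^]\<^bsub>W\<^esub> n = p (a [^] n) \<and> a [^] n \<in> K.cone" for n :: nat
    using a by (induction n) (simp_all add: p_def K.one_cone K.p_one[unfolded p_def]
      K.cone_mult K.p_cone(3)[unfolded p_def])
  then have "grp_le W (p a [^]\<^bsub>W\<^esub> n) w"
    using k2.closed'(3)[OF cone_Gamma, of "a [^] n"] by (simp add: p_def K.cone_def)
  then have pow_le: "grp_le W (p a [^]\<^bsub>W\<^esub> n) (\<kappa>\<^sub>1 h [^]\<^bsub>W\<^esub> n)"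
    using W.grp_le_trans[OF _ w_le] c W.u_closed by simp
  have "p a \<otimes>\<^bsub>W\<^esub> \<kappa>\<^sub>1 h = \<kappa>\<^sub>1 h \<otimes>\<^bsub>W\<^esub> p a"
    by (rule k1_p_commute[symmetric]) (use h a in simp_all)
  then show ?thesis
    by (rule W.grp_le_of_pow_le[OF c(2,1) _ pow_le n0])
qed

lemma K_le_k1:
  assumes h: "h \<in> H" "0 < h" "h \<le> 1" and g: "g \<in> carrier G"
  shows "grp_le W (K g) (\<kappa>\<^sub>1 h)"
proof -
  obtain a where a: "a \<in> K.cone" "grp_le W (K g) (p a)" using K.ext_bounded[OF g] by blast
  then show ?thesis
    using W.grp_le_trans[OF a(2) p_le_k1[OF h a(1)]] k1_closed[of h] h g
    by (simp add: K.p_cone K.ext_closed)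
qed

lemma one_le_k1_K:
  assumes h: "h \<in> H" "0 < h" "h \<le> 1" and g: "g \<in> carrier G"
  shows "grp_le W \<one>\<^bsub>W\<^esub> (\<kappa>\<^sub>1 h \<otimes>\<^bsub>W\<^esub> K g)"
  using K_le_k1[OF h, of "inv g"] k1_closed[of h] h g W.grp_le_right_mult_iff(2)[of "\<one>\<^bsub>W\<^esub>" "\<kappa>\<^sub>1 h" "K g"]
  by (simp add: K.ext_inv K.ext_closed)

definition \<psi> where "\<psi> = (\<lambda>(h, g). \<kappa>\<^sub>1 h \<otimes>\<^bsub>W\<^esub> K g)"

lemma psi_closed:
  assumes "x \<in> carrier (Gamma L (1, \<one>))"
  shows "\<psi> x \<in> carrier (Gamma W w)"
proof -
  obtain h g where x: "x = (h, g)" by (cases x)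
  have hg: "h \<in> H" "0 \<le> h" "h \<le> 1" "g \<in> carrier G"
    and cases: "0 < h \<or> h = 0 \<and> grp_le G \<one> g" "h < 1 \<or> h = 1 \<and> grp_le G g \<one>"
    using assms by (auto simp: x Gamma_lex_simps)
  note c = k1_closed(1)[OF hg(1-3)] K.ext_closed[OF hg(4)]
  have "grp_le W \<one>\<^bsub>W\<^esub> (\<psi> x)"
    using cases(1) one_le_k1_K[OF hg(1) _ hg(3,4)] hg K.p_cone(1,2)[of g]
    by (auto simp: \<psi>_def x k1_zero K.ext_cone K.cone_def)
  moreover have "grp_le W (\<psi> x) w"
  proof (cases "h < 1")
    case True
    \<comment> \<open>The room left below \<open>w\<close> is
      \<open>\<kappa>\<^sub>1 (1 - h)\<close>. Since \<open>1 - h\<close> is positive, it dominates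
      every value of \<open>K\<close>.\<close>
    then have "grp_le W (\<kappa>\<^sub>1 h \<otimes>\<^bsub>W\<^esub> K g) (\<kappa>\<^sub>1 h \<otimes>\<^bsub>W\<^esub> \<kappa>\<^sub>1 (1 - h))"
      using K_le_k1[of "1 - h" g] hg c k1_closed(1)[of "1 - h"]
      by (simp add: W.grp_le_mult_left_iff diff_in one_in)
    then show ?thesis using hg by (simp add: \<psi>_def x k1_compl)
  next
    case False
    then have h: "h = 1" and g: "grp_le G g \<one>" using cases(2) by auto
    have "inv g \<in> K.cone"
      using g hg grp_le_inv_iff[of \<one> g] by (simp add: K.cone_def)
    then have "grp_le W (inv\<^bsub>W\<^esub> \<one>\<^bsub>W\<^esub>) (inv\<^bsub>W\<^esub> (K g))"
      using K.p_cone(2)[of "inv g"] hg by (simp add: K.ext_inv flip: K.ext_cone)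
    then have "grp_le W (K g) \<one>\<^bsub>W\<^esub>"
      using c by (subst (asm) W.grp_le_inv_iff) simp_all
    then have "grp_le W (w \<otimes>\<^bsub>W\<^esub> K g) (w \<otimes>\<^bsub>W\<^esub> \<one>\<^bsub>W\<^esub>)"
      using c W.u_closed by (subst W.grp_le_mult_left_iff) simp_all
    then show ?thesis using W.u_closed by (simp add: \<psi>_def x h k1_one)
  qed
  ultimately show ?thesis using c by (simp add: W.Gamma_simps \<psi>_def x)
qed

lemma psi_neg:
  assumes "x \<in> carrier (Gamma L (1, \<one>))"
  shows "\<psi> (lneg (Gamma L (1, \<one>)) x) = lneg (Gamma W w) (\<psi> x)"
    and "\<psi> (rneg (Gamma L (1, \<one>)) x) = rneg (Gamma W w) (\<psi> x)"
proof -
  obtain h g where x: "x = (h, g)" by (cases x)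
  have hg: "h \<in> H" "0 \<le> h" "h \<le> 1" "g \<in> carrier G"
    using assms by (auto simp: x Gamma_lex_simps)
  note c = k1_closed(1)[OF hg(1-3)] K.ext_closed[OF hg(4)]
  have c': "\<kappa>\<^sub>1 (1 - h) \<in> carrier W" using hg by (intro k1_closed) (simp_all add: diff_in one_in)
  \<comment> \<open>\<open>w\<close> is split with \<open>\<kappa>\<^sub>1 h\<close> on the right,
    and the factors of \<open>\<psi> x\<close> are swapped, so that
    \<open>\<kappa>\<^sub>1 h\<close> meets its inverse. For the other negation the split is
    mirrored.\<close>
  have "lneg (Gamma W w) (\<psi> x) = \<kappa>\<^sub>1 (1 - h) \<otimes>\<^bsub>W\<^esub> \<kappa>\<^sub>1 h \<otimes>\<^bsub>W\<^esub> inv\<^bsub>W\<^esub> (K g \<otimes>\<^bsub>W\<^esub> \<kappa>\<^sub>1 h)"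
    using hg by (simp add: W.Gamma_simps \<psi>_def x k1_compl k1_K_commute)
  also have "\<dots> = \<kappa>\<^sub>1 (1 - h) \<otimes>\<^bsub>W\<^esub> K (inv g)"
    using c c' hg by (simp add: W.inv_mult_group W.m_assoc W.inv_cancel_left K.ext_inv)
  finally show "\<psi> (lneg (Gamma L (1, \<one>)) x) = lneg (Gamma W w) (\<psi> x)"
    using hg by (simp add: x Gamma_lex_simps \<psi>_def)
  have "rneg (Gamma W w) (\<psi> x) = inv\<^bsub>W\<^esub> (\<kappa>\<^sub>1 h \<otimes>\<^bsub>W\<^esub> K g) \<otimes>\<^bsub>W\<^esub> (\<kappa>\<^sub>1 h \<otimes>\<^bsub>W\<^esub> \<kappa>\<^sub>1 (1 - h))"
    using hg by (simp add: W.Gamma_simps \<psi>_def x k1_compl)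
  also have "\<dots> = K (inv g) \<otimes>\<^bsub>W\<^esub> \<kappa>\<^sub>1 (1 - h)"
    using c c' hg by (simp add: W.inv_mult_group W.m_assoc W.inv_cancel_left K.ext_inv)
  also have "\<dots> = \<kappa>\<^sub>1 (1 - h) \<otimes>\<^bsub>W\<^esub> K (inv g)"
    using hg by (intro k1_K_commute[symmetric]) (simp_all add: diff_in one_in)
  finally show "\<psi> (rneg (Gamma L (1, \<one>)) x) = rneg (Gamma W w) (\<psi> x)"
    using hg by (simp add: x Gamma_lex_simps \<psi>_def)
qed

lemma psi_oplus:
  assumes "x \<in> carrier (Gamma L (1, \<one>))" "y \<in> carrier (Gamma L (1, \<one>))"
  shows "\<psi> (x \<oplus>\<^bsub>Gamma L (1, \<one>)\<^esub> y) = \<psi> x \<oplus>\<^bsub>Gamma W w\<^esub> \<psi> y"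
proof -
  obtain h g where x: "x = (h, g)" by (cases x)
  have hg: "h \<in> H" "0 \<le> h" "h \<le> 1" "g \<in> carrier G"
    using assms by (auto simp: x Gamma_lex_simps)
  obtain h' g' where y: "y = (h', g')" by (cases y)
  have hg': "h' \<in> H" "0 \<le> h'" "h' \<le> 1" "g' \<in> carrier G"
    using assms by (auto simp: y Gamma_lex_simps)
  note c = k1_closed(1)[OF hg(1-3)] K.ext_closed[OF hg(4)]
    k1_closed(1)[OF hg'(1-3)] K.ext_closed[OF hg'(4)]
  have gg: "g \<otimes> g' \<in> carrier G" using hg hg' by simp
  have prod: "\<psi> x \<otimes>\<^bsub>W\<^esub> \<psi> y = (\<kappa>\<^sub>1 h \<otimes>\<^bsub>W\<^esub> \<kappa>\<^sub>1 h') \<otimes>\<^bsub>W\<^esub> K (g \<otimes> g')"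
  proof -
    have "\<psi> x \<otimes>\<^bsub>W\<^esub> \<psi> y = \<kappa>\<^sub>1 h \<otimes>\<^bsub>W\<^esub> (K g \<otimes>\<^bsub>W\<^esub> \<kappa>\<^sub>1 h') \<otimes>\<^bsub>W\<^esub> K g'"
      using c by (simp add: \<psi>_def x y W.m_assoc)
    also have "K g \<otimes>\<^bsub>W\<^esub> \<kappa>\<^sub>1 h' = \<kappa>\<^sub>1 h' \<otimes>\<^bsub>W\<^esub> K g" using hg hg' by (simp add: k1_K_commute)
    finally show ?thesis using c hg hg' by (simp add: W.m_assoc K.ext_mult)
  qed
  \<comment> \<open>The truncation in the lexicographic interval is inactive, acts on the second
    coordinate only, or is total, according to the sum of the first coordinates.\<close>
  consider "h + h' < 1" | "h + h' = 1" | "1 < h + h'" by linarith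
  then show ?thesis
  proof cases
    case 1
    have "x \<oplus>\<^bsub>Gamma L (1, \<one>)\<^esub> y = (h + h', g \<otimes> g')"
      using 1 hg hg' by (simp add: x y Gamma_lex_simps)
    then have e: "\<psi> (x \<oplus>\<^bsub>Gamma L (1, \<one>)\<^esub> y) = \<psi> x \<otimes>\<^bsub>W\<^esub> \<psi> y"
      using 1 hg hg' by (simp add: prod k1_plus) (simp add: \<psi>_def k1_plus)
    \<comment> \<open>The untruncated product is a value of \<open>\<psi>\<close> on the interval,
      hence below \<open>w\<close>; so the truncation in \<open>W\<close> is inactive too.\<close>
    then have "grp_le W (\<psi> x \<otimes>\<^bsub>W\<^esub> \<psi> y) w"
      using psi_closed[OF L.pseudo_MV_Gamma[THEN pseudo_MV.oplus_closed, OF assms]]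
      by (simp add: W.Gamma_simps)
    then show ?thesis
      using e c W.u_closed by (simp add: W.Gamma_simps W.meet_absorb \<psi>_def x y)
  next
    case 2
    then have h': "h' = 1 - h" by simp
    have "x \<oplus>\<^bsub>Gamma L (1, \<one>)\<^esub> y = (1, meet (g \<otimes> g') \<one>)"
      using 2 hg hg' by (simp add: x y Gamma_lex_simps)
    then have "\<psi> (x \<oplus>\<^bsub>Gamma L (1, \<one>)\<^esub> y) = w \<otimes>\<^bsub>W\<^esub> W.meet (K (g \<otimes> g')) \<one>\<^bsub>W\<^esub>"
      using gg by (simp add: \<psi>_def k1_one K.ext_meet_one)
    also have "\<dots> = W.meet (w \<otimes>\<^bsub>W\<^esub> K (g \<otimes> g')) w"
      using gg W.u_closed by (simp add: W.mult_meet_left K.ext_closed)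
    also have "w \<otimes>\<^bsub>W\<^esub> K (g \<otimes> g') = \<psi> x \<otimes>\<^bsub>W\<^esub> \<psi> y"
      using prod k1_compl(1)[OF hg(1-3)] h' by simp
    finally show ?thesis by (simp add: W.Gamma_simps)
  next
    case 3
    \<comment> \<open>The excess of \<open>h + h'\<close> over 1. Splitting it off \<open>h'\<close>
      exhibits the product as \<open>w\<close> times an element that is positive because
      \<open>?e\<close> is.\<close>
    let ?e = "h' - (1 - h)"
    have e: "?e \<in> H" "0 < ?e" "?e \<le> 1" "1 - h \<in> H"
      using 3 hg hg' by (simp_all add: diff_in one_in)
    have c': "\<kappa>\<^sub>1 (1 - h) \<in> carrier W" "\<kappa>\<^sub>1 ?e \<in> carrier W"
      using e hg by (auto intro: k1_closed)
    have "\<kappa>\<^sub>1 h' = \<kappa>\<^sub>1 (1 - h) \<otimes>\<^bsub>W\<^esub> \<kappa>\<^sub>1 ?e"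
      using k1_plus[of "1 - h" ?e] e hg hg' by simp
    then have "\<psi> x \<otimes>\<^bsub>W\<^esub> \<psi> y = (\<kappa>\<^sub>1 h \<otimes>\<^bsub>W\<^esub> \<kappa>\<^sub>1 (1 - h)) \<otimes>\<^bsub>W\<^esub> (\<kappa>\<^sub>1 ?e \<otimes>\<^bsub>W\<^esub> K (g \<otimes> g'))"
      using prod c c' gg by (simp add: W.m_assoc K.ext_closed)
    also have "\<dots> = w \<otimes>\<^bsub>W\<^esub> (\<kappa>\<^sub>1 ?e \<otimes>\<^bsub>W\<^esub> K (g \<otimes> g'))"
      using hg by (simp only: k1_compl)
    finally have "grp_le W w (\<psi> x \<otimes>\<^bsub>W\<^esub> \<psi> y)"
      using one_le_k1_K[OF e(1-3) gg] c' gg W.u_closed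
        W.grp_le_mult_left_iff[of "\<one>\<^bsub>W\<^esub>" "\<kappa>\<^sub>1 ?e \<otimes>\<^bsub>W\<^esub> K (g \<otimes> g')" w]
      by (simp add: K.ext_closed)
    then have "\<psi> x \<oplus>\<^bsub>Gamma W w\<^esub> \<psi> y = w"
      using c W.u_closed by (simp add: W.Gamma_simps W.meet_absorb \<psi>_def x y)
    moreover have "x \<oplus>\<^bsub>Gamma L (1, \<one>)\<^esub> y = (1, \<one>)"
      using 3 hg hg' by (simp add: x y Gamma_lex_simps)
    ultimately show ?thesis using W.u_closed by (simp add: \<psi>_def k1_one K.ext_one)
  qed
qed

lemma psi_hom: "\<psi> \<in> pmv_hom (Gamma L (1, \<one>)) (Gamma W w)"
  using psi_closed psi_neg psi_oplus W.u_closed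
  by (auto simp: pmv_hom_def Gamma_lex_simps(5,6) W.Gamma_simps(5,6))
     (simp_all add: \<psi>_def k1_zero k1_one K.ext_one)

lemma psi_left:
  assumes "h \<in> carrier (Gamma (additive_group H) 1)" shows "\<psi> (h, \<one>) = \<kappa>\<^sub>1 h"
  using k1.closed'(1)[OF assms] by (simp add: \<psi>_def K.ext_one)

text \<open>Only \<open>n = 0\<close> and \<open>n = 1\<close> occur in the integer interval, and
  \<open>(1, g)\<close> is the negation of the infinitesimal element
  \<open>(0, inv g)\<close>.\<close>

lemma psi_right:
  assumes "(n, g) \<in> carrier (Gamma Z.L (1, \<one>))" shows "\<psi> (of_int n, g) = \<kappa>\<^sub>2 (n, g)"
proof -
  consider "n = 0" "g \<in> K.cone" | "n = 1" "g \<in> carrier G" "grp_le G g \<one>"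
    using assms by (auto simp: Z.Gamma_lex_simps K.cone_def)
  then show ?thesis
  proof cases
    case 1
    then show ?thesis using K.p_cone(1)[of g] by (simp add: \<psi>_def k1_zero K.ext_cone) (simp add: p_def)
  next
    case 2
    then have ig: "inv g \<in> K.cone"
      using grp_le_inv_iff[of \<one> g] by (simp add: K.cone_def)
    have "\<kappa>\<^sub>2 (lneg (Gamma Z.L (1, \<one>)) (0, inv g)) = lneg (Gamma W w) (\<kappa>\<^sub>2 (0, inv g))"
      using ig by (intro k2.hom_lneg cone_Gamma) (auto simp: K.cone_def)
    then have "\<kappa>\<^sub>2 (1, g) = w \<otimes>\<^bsub>W\<^esub> inv\<^bsub>W\<^esub> K (inv g)"
      using 2 ig by (simp add: Z.Gamma_lex_simps W.Gamma_simps K.ext_cone p_def)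
    then show ?thesis using 2 by (simp add: \<psi>_def k1_one K.ext_inv K.ext_closed)
  qed
qed

end

section \<open>The lexicographic model of the weak free product\<close>

lemma pmv_span_subset:
  assumes "pmv_closed A" "X \<subseteq> carrier A" shows "pmv_span A X \<subseteq> carrier A"
  using pmv_subuniverse_span[OF assms] by (simp add: pmv_subuniverse_def)

text \<open>Preimages of subuniverses are subuniverses.\<close>

lemma pmv_span_image:
  assumes f: "f \<in> pmv_hom A B" and A: "pmv_closed A" "X \<subseteq> carrier A" and x: "x \<in> pmv_span A X"
  shows "f x \<in> pmv_span B (f ` X)"
proof -
  have "f x \<in> S" if S: "pmv_subuniverse B S" "f ` X \<subseteq> S" for S
  proof -
    have "pmv_subuniverse A {x \<in> carrier A. f x \<in> S}"
      using f A S by (auto simp: pmv_subuniverse_def pmv_hom_def pmv_closed_def)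
    then show ?thesis using x A S by (auto simp: pmv_span_def)
  qed
  then show ?thesis by (auto simp: pmv_span_def)
qed

lemma pmv_hom_restrict:
  assumes "f \<in> pmv_hom A B" "pmv_closed A"
  shows "restrict f (carrier A) \<in> pmv_hom A B"
  using assms by (auto simp: pmv_hom_def pmv_closed_def pmv_subuniverse_def)

text \<open>Both composites agree with the identity on a generating set, hence everywhere.\<close>

lemma pmv_iso_of_inverse_on_generators:
  assumes f: "f \<in> pmv_hom A B" and g: "g \<in> pmv_hom B A"
    and A: "pmv_closed A" "X \<subseteq> carrier A" "pmv_span A X = carrier A"
    and B: "pmv_closed B" "Y \<subseteq> carrier B" "pmv_span B Y = carrier B"
    and gf: "\<And>x. x \<in> X \<Longrightarrow> g (f x) = x" and fg: "\<And>y. y \<in> Y \<Longrightarrow> f (g y) = y"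
  shows "f \<in> pmv_iso A B"
proof -
  have id: "(\<lambda>x. x) \<in> pmv_hom C C" for C :: "'c pmv" by (simp add: pmv_hom_def)
  have gf': "g (f x) = x" if "x \<in> carrier A" for x
    using pmv_hom_eq_on_span[OF pmv_hom_comp[OF f g] id, of X x] A gf that by simp
  have fg': "f (g y) = y" if "y \<in> carrier B" for y
    using pmv_hom_eq_on_span[OF pmv_hom_comp[OF g f] id, of Y y] B fg that by simp
  have "bij_betw f (carrier A) (carrier B)"
    by (rule bij_betw_byWitness[of _ g]) (use f g gf' fg' in \<open>auto simp: pmv_hom_def\<close>)
  then show ?thesis using f by (simp add: pmv_iso_def)
qed

lemma pmv_isomorphic_sym:
  assumes "A \<cong>\<^sub>M B" "pmv_closed A" shows "B \<cong>\<^sub>M A"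
  using assms pmv_iso_inv unfolding pmv_isomorphic_def by blast

lemma pmv_isomorphic_trans:
  assumes "A \<cong>\<^sub>M B" "B \<cong>\<^sub>M C" shows "A \<cong>\<^sub>M C"
  using assms pmv_iso_comp unfolding pmv_isomorphic_def by blast

lemma pmv_isomorphic_refl: "A \<cong>\<^sub>M A"
proof -
  have "(\<lambda>x. x) \<in> pmv_iso A A" by (simp add: pmv_iso_def pmv_hom_def bij_betw_def)
  then show ?thesis unfolding pmv_isomorphic_def by blast
qed

section \<open>The algebra \<open>N\<close> and the copies of the two factors generating it\<close>

context lex_l_group
begin

abbreviation N where "N \<equiv> Gamma L (1, \<one>)"

definition emb1 :: "'a \<Rightarrow> 'a \<times> 'g" where "emb1 h = (h, \<one>)"
definition emb2 :: "int \<times> 'g \<Rightarrow> 'a \<times> 'g" where "emb2 = (\<lambda>(n, g). (of_int n, g))"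

lemma emb1_hom: "emb1 \<in> pmv_hom (Gamma (additive_group H) 1) N"
  by (auto simp: pmv_hom_def emb1_def Gamma_additive_simps Gamma_lex_simps grp_le_refl meet_absorb
      min_def)

lemma emb2_hom: "emb2 \<in> pmv_hom (Gamma Z.L (1, \<one>)) N"
proof -
  have sum: "emb2 (x \<oplus>\<^bsub>Gamma Z.L (1, \<one>)\<^esub> y) = emb2 x \<oplus>\<^bsub>N\<^esub> emb2 y"
    if "x \<in> carrier (Gamma Z.L (1, \<one>))" "y \<in> carrier (Gamma Z.L (1, \<one>))" for x y
    using that
    by (cases x; cases y) (auto simp: emb2_def Z.Gamma_lex_simps Gamma_lex_simps zero_in one_in)
  have neg: "emb2 (lneg (Gamma Z.L (1, \<one>)) x) = lneg N (emb2 x)"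
      "emb2 (rneg (Gamma Z.L (1, \<one>)) x) = rneg N (emb2 x)" "emb2 x \<in> carrier N"
    if "x \<in> carrier (Gamma Z.L (1, \<one>))" for x
    using that by (cases x; auto simp: emb2_def Z.Gamma_lex_simps Gamma_lex_simps zero_in one_in)+
  show ?thesis
    unfolding pmv_hom_def using sum neg
    by (auto simp: Z.Gamma_lex_simps(5,6) Gamma_lex_simps(5,6)) (simp_all add: emb2_def)
qed

lemma inj_emb1: "inj emb1" and inj_emb2: "inj emb2"
  by (auto simp: inj_def emb1_def emb2_def)

definition gens where "gens = emb1 ` carrier (Gamma (additive_group H) 1) \<union> emb2 ` carrier (Gamma Z.L (1, \<one>))"

lemma gens_sub: "gens \<subseteq> carrier N"
  using emb1_hom emb2_hom by (auto simp: gens_def pmv_hom_def)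

lemma N_closed: "pmv_closed N"
  by (rule pseudo_MV.pmv_closed[OF L.pseudo_MV_Gamma])

lemma N_generated: "pmv_span N gens = carrier N"
proof
  show "pmv_span N gens \<subseteq> carrier N" by (rule pmv_span_subset[OF N_closed gens_sub])
  let ?S = "pmv_span N gens"
  have S: "pmv_subuniverse N ?S" by (rule pmv_subuniverse_span[OF N_closed gens_sub])
  then have S_oplus: "\<And>x y. \<lbrakk>x \<in> ?S; y \<in> ?S\<rbrakk> \<Longrightarrow> x \<oplus>\<^bsub>N\<^esub> y \<in> ?S"
    and S_lneg: "\<And>x. x \<in> ?S \<Longrightarrow> lneg N x \<in> ?S"
    by (simp_all add: pmv_subuniverse_def)
  have gens: "x \<in> gens \<Longrightarrow> x \<in> ?S" for x by (auto simp: pmv_span_def)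
  have X1: "(h, \<one>) \<in> ?S" if "h \<in> carrier (Gamma (additive_group H) 1)" for h
    using that gens by (auto simp: gens_def emb1_def)
  have X2: "(of_int n, g) \<in> ?S" if "(n, g) \<in> carrier (Gamma Z.L (1, \<one>))" for n g
    using gens[of "emb2 (n, g)"] that by (simp add: gens_def) (simp add: emb2_def)
  show "carrier N \<subseteq> ?S"
  proof
    fix x assume x: "x \<in> carrier N"
    obtain h g where hg: "x = (h, g)" by (cases x)
    consider "h = 0" | "h = 1" | "0 < h" "h < 1" using x by (auto simp: hg Gamma_lex_simps)
    then show "x \<in> ?S"
    proof cases
      case 1
      then show ?thesis using X2[of 0 g] x by (simp add: hg Gamma_lex_simps Z.Gamma_lex_simps)
    next
      case 2
      then show ?thesis using X2[of 1 g] x by (simp add: hg Gamma_lex_simps Z.Gamma_lex_simps)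
    next
      case 3
      have c: "h \<in> H" "g \<in> carrier G" using x by (auto simp: hg Gamma_lex_simps)
      obtain a b where ab: "a \<in> carrier G" "b \<in> carrier G" "grp_le G \<one> a" "grp_le G \<one> b"
        "g = a \<otimes> inv b"
        using difference[OF c(2)] .
      have "(h, \<one>) \<in> ?S" using X1 3 c by (simp add: Gamma_additive_simps)
      moreover have "(0, a) \<in> ?S" "(0, b) \<in> ?S"
        using X2[of 0 a] X2[of 0 b] ab by (simp_all add: Z.Gamma_lex_simps)
      \<comment> \<open>With \<open>g = a \<otimes> inv b\<close>, the part \<open>a\<close> is
        added directly and \<open>b\<close> is subtracted by adding it to the complement. As
        \<open>0 < h < 1\<close>, no sum on the way is truncated.\<close>
      ultimately have "lneg N ((0, b) \<oplus>\<^bsub>N\<^esub> lneg N ((h, \<one>) \<oplus>\<^bsub>N\<^esub> (0, a))) \<in> ?S"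
        by (intro S_lneg S_oplus)
      also have "lneg N ((0, b) \<oplus>\<^bsub>N\<^esub> lneg N ((h, \<one>) \<oplus>\<^bsub>N\<^esub> (0, a))) = x"
        using 3 c ab by (simp add: Gamma_lex_simps zero_in one_in diff_in inv_mult_group hg)
      finally show ?thesis .
    qed
  qed
qed

end

text \<open>The interval \<open>[0, 1]\<close> of \<open>H\<close> together with the integer parts recovers \<open>H\<close>, and the
  positive cone of \<open>G\<close> recovers \<open>G\<close> through differences.\<close>

lemma lex_carrier_embeds:
  fixes H :: "real set" and G :: "'g ordered_group"
  assumes LG: "lex_l_group H G" and inf: "infinite (UNIV :: 'w set)"
    and i1: "inj_on (i1 :: real \<Rightarrow> 'w) (carrier (Gamma (additive_group H) 1))"
    and i2: "inj_on (i2 :: int \<times> 'g \<Rightarrow> 'w)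
      (carrier (Gamma (additive_group (UNIV :: int set) \<times>\<^sub>l\<^sub>e\<^sub>x G) (1, \<one>\<^bsub>G\<^esub>)))"
  shows "\<exists>j :: real \<times> 'g \<Rightarrow> 'w. inj_on j (carrier (additive_group H \<times>\<^sub>l\<^sub>e\<^sub>x G))"
proof -
  include cardinal_syntax
  interpret lex_l_group H G by (rule LG)
  let ?C1 = "carrier (Gamma (additive_group H) 1)" and ?C2 = "carrier (Gamma Z.L (1, \<one>\<^bsub>G\<^esub>))"
  let ?U = "|UNIV :: 'w set|"
  have C: "|?C1| \<le>o ?U" "|?C2| \<le>o ?U"
    using i1 i2 by (auto simp flip: card_of_ordLeq)
  have "|UNIV :: int set| \<le>o |UNIV :: nat set|"
    using bij_int_encode by (auto simp: bij_def simp flip: card_of_ordLeq)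
  then have int: "|UNIV :: int set| \<le>o ?U"
    using inf ordLeq_transitive by (metis infinite_iff_card_of_nat)
  \<comment> \<open>A number is determined by its fractional part, which lies in \<open>H\<close>
    because \<open>H\<close> contains the integers, and its floor.\<close>
  have "inj_on (\<lambda>h. (h - of_int \<lfloor>h\<rfloor>, \<lfloor>h\<rfloor>)) H" by (auto simp: inj_on_def)
  moreover have "(\<lambda>h. (h - of_int \<lfloor>h\<rfloor>, \<lfloor>h\<rfloor>)) ` H \<subseteq> ?C1 \<times> UNIV"
    by (auto simp: Gamma_additive_simps diff_in of_int_in) linarith
  ultimately have "|H| \<le>o |?C1 \<times> (UNIV :: int set)|"
    by (subst card_of_ordLeq[symmetric]) blast
  then have H: "|H| \<le>o ?U"
    by (rule ordLeq_transitive) (use C(1) int in \<open>auto intro: card_of_Sigma_ordLeq_infinite[OF inf]\<close>)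
  let ?d = "\<lambda>g. ((0 :: int, g \<otimes>\<^bsub>G\<^esub> inv\<^bsub>G\<^esub> (meet g \<one>\<^bsub>G\<^esub>)), (0 :: int, inv\<^bsub>G\<^esub> (meet g \<one>\<^bsub>G\<^esub>)))"
  have d: "?d g \<in> ?C2 \<times> ?C2 \<and>
      g = snd (fst (?d g)) \<otimes>\<^bsub>G\<^esub> inv\<^bsub>G\<^esub> snd (snd (?d g))" if "g \<in> carrier G" for g
  proof -
    obtain a b where ab: "grp_le G \<one>\<^bsub>G\<^esub> a" "grp_le G \<one>\<^bsub>G\<^esub> b"
      "a = g \<otimes>\<^bsub>G\<^esub> inv\<^bsub>G\<^esub> (meet g \<one>\<^bsub>G\<^esub>)" "b = inv\<^bsub>G\<^esub> (meet g \<one>\<^bsub>G\<^esub>)"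
      using difference[OF \<open>g \<in> carrier G\<close>] .
    note ab(1,2)[unfolded ab(3,4)]
    then show ?thesis
      using \<open>g \<in> carrier G\<close> by (simp add: Z.Gamma_lex_simps meet_closed m_assoc)
  qed
  have "inj_on ?d (carrier G)"
    by (rule inj_onI) (metis d)
  moreover have "?d ` carrier G \<subseteq> ?C2 \<times> ?C2" using d by blast
  ultimately have "|carrier G| \<le>o |?C2 \<times> ?C2|"
    by (subst card_of_ordLeq[symmetric]) blast
  then have "|carrier G| \<le>o ?U"
    by (rule ordLeq_transitive) (use C(2) in \<open>auto intro: card_of_Sigma_ordLeq_infinite[OF inf]\<close>)
  then have "|H \<times> carrier G| \<le>o ?U"
    using H by (auto intro: card_of_Sigma_ordLeq_infinite[OF inf])
  then show ?thesis by (auto simp: lex_simps simp flip: card_of_ordLeq)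
qed

text \<open>\<open>A1\<close> and \<open>A2\<close> stand for the quotient and the generated
  subalgebra, known only through isomorphisms onto the two intervals; closedness allows these to be
  inverted.\<close>

locale lex_model = lex_l_group H G
  for H :: "real set" and G :: "'g ordered_group" (structure) +
  fixes A1 :: "'b pmv" and A2 :: "'c pmv" and f1 f2
  assumes f1: "f1 \<in> pmv_iso A1 (Gamma (additive_group H) 1)"
    and f2: "f2 \<in> pmv_iso A2 (Gamma Z.L (1, \<one>))"
    and A1_closed: "pmv_closed A1" and A2_closed: "pmv_closed A2"
begin

lemma f_hom: "f1 \<in> pmv_hom A1 (Gamma (additive_group H) 1)" "f2 \<in> pmv_hom A2 (Gamma Z.L (1, \<one>))"
  and f_bij: "bij_betw f1 (carrier A1) (carrier (Gamma (additive_group H) 1))"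
    "bij_betw f2 (carrier A2) (carrier (Gamma Z.L (1, \<one>)))"
  using f1 f2 by (auto simp: pmv_iso_def)

lemma gens_eq: "gens = (emb1 \<circ> f1) ` carrier A1 \<union> (emb2 \<circ> f2) ` carrier A2"
  by (simp only: gens_def f_bij[THEN bij_betw_imp_surj_on, symmetric] image_comp)

lemma emb_hom: "emb1 \<circ> f1 \<in> pmv_hom A1 N" "emb2 \<circ> f2 \<in> pmv_hom A2 N"
  using pmv_hom_comp f_hom emb1_hom emb2_hom by blast+

lemma emb_commute:
  assumes "a \<in> carrier A1" "b \<in> carrier A2"
  shows "emb1 (f1 a) \<otimes>\<^bsub>L\<^esub> emb2 (f2 b) = emb2 (f2 b) \<otimes>\<^bsub>L\<^esub> emb1 (f1 a)"
  using assms f_bij[THEN bij_betwE]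
  by (cases "f2 b") (auto simp: emb1_def emb2_def lex_simps Z.Gamma_lex_simps)

text \<open>The existence half of the universal property of \<open>N\<close>, obtained by pulling
  the pair back along the inverses of \<open>f1\<close> and \<open>f2\<close>. It also supplies the
  map from \<open>N\<close> to an arbitrary weak free product.\<close>

lemma universal:
  fixes W :: "'w ordered_group"
  assumes W: "unital_l_group W w"
    and k: "\<kappa>\<^sub>1 \<in> pmv_hom A1 (Gamma W w)" "\<kappa>\<^sub>2 \<in> pmv_hom A2 (Gamma W w)"
    and comm: "commuting_sums W (carrier A1) (carrier A2) \<kappa>\<^sub>1 \<kappa>\<^sub>2"
  obtains \<chi> where "\<chi> \<in> pmv_hom N (Gamma W w)"
    "\<And>a. a \<in> carrier A1 \<Longrightarrow> \<chi> (emb1 (f1 a)) = \<kappa>\<^sub>1 a"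
    "\<And>b. b \<in> carrier A2 \<Longrightarrow> \<chi> (emb2 (f2 b)) = \<kappa>\<^sub>2 b"
proof -
  let ?g1 = "inv_into (carrier A1) f1" and ?g2 = "inv_into (carrier A2) f2"
  have g: "?g1 \<in> pmv_hom (Gamma (additive_group H) 1) A1" "?g2 \<in> pmv_hom (Gamma Z.L (1, \<one>)) A2"
    using pmv_iso_inv[OF f1 A1_closed] pmv_iso_inv[OF f2 A2_closed] by (simp_all add: pmv_iso_def)
  have gf: "?g1 (f1 a) = a" if "a \<in> carrier A1" for a
    using f_bij that by (simp add: bij_betw_def)
  have gf': "?g2 (f2 b) = b" if "b \<in> carrier A2" for b
    using f_bij that by (simp add: bij_betw_def)
  interpret W: l_group_interval W w
    using W by (auto simp: unital_l_group_def l_group_interval_def l_group_interval_axioms_def)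
  have "commuting_sums W (carrier (Gamma (additive_group H) 1)) (carrier (Gamma Z.L (1, \<one>)))
      (\<kappa>\<^sub>1 \<circ> ?g1) (\<kappa>\<^sub>2 \<circ> ?g2)"
    using comm g by (auto simp: commuting_sums_def pmv_hom_def)
  then interpret P: commuting_pair H G W w "\<kappa>\<^sub>1 \<circ> ?g1" "\<kappa>\<^sub>2 \<circ> ?g2"
    by unfold_locales (use pmv_hom_comp g k in blast)+
  show thesis
  proof (rule that[OF P.psi_hom])
    fix a assume a: "a \<in> carrier A1"
    then show "P.\<psi> (emb1 (f1 a)) = \<kappa>\<^sub>1 a"
      using P.psi_left[of "f1 a"] f_bij[THEN bij_betwE] gf by (auto simp: emb1_def)
  next
    fix b assume b: "b \<in> carrier A2"
    then show "P.\<psi> (emb2 (f2 b)) = \<kappa>\<^sub>2 b"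
      using P.psi_right[of "fst (f2 b)" "snd (f2 b)"] f_bij[THEN bij_betwE] gf'
      by (auto simp: emb2_def split_def)
  qed
qed

end

section \<open>Weak free products tested over \<open>'w\<close>, with \<open>N\<close> copied into
  it\<close>

locale lex_model_in = lex_model H G A1 A2 f1 f2 + l_group_transport L "(1, \<one>)" j
  for H and G :: "'g ordered_group" (structure) and A1 :: "'b pmv" and A2 :: "'c pmv" and f1 f2
    and j :: "real \<times> 'g \<Rightarrow> 'w"
begin

lemma T_unital: "unital_l_group T (j (1, \<one>))"
  using unital_transport unital_lex reals_Archimedean2 by blast

lemma T_emb:
  "j \<circ> (emb1 \<circ> f1) \<in> pmv_hom A1 (Gamma T (j (1, \<one>)))"
  "j \<circ> (emb2 \<circ> f2) \<in> pmv_hom A2 (Gamma T (j (1, \<one>)))"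
  using pmv_hom_comp emb_hom transport_iso by (auto simp: pmv_iso_def simp del: comp_apply)

lemma T_commuting:
  "commuting_sums T (carrier A1) (carrier A2) (j \<circ> (emb1 \<circ> f1)) (j \<circ> (emb2 \<circ> f2))"
proof -
  have "(emb1 \<circ> f1) a \<in> carrier L" if "a \<in> carrier A1" for a
    using that emb_hom(1) by (auto simp: pmv_hom_def L.Gamma_simps)
  moreover have "(emb2 \<circ> f2) b \<in> carrier L" if "b \<in> carrier A2" for b
    using that emb_hom(2) by (auto simp: pmv_hom_def L.Gamma_simps)
  ultimately show ?thesis
    by (simp add: commuting_sums_def transport_simps emb_commute)
qed

lemma T_variety: "in_symmetric_variety (Gamma T (j (1, \<one>)))"
proof (rule T.in_symmetric_variety_Gamma)
  \<comment> \<open>The first coordinate, read off through the inverse of \<open>j\<close>.\<close>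
  let ?s = "\<lambda>x. fst (inv_into (carrier L) j x)"
  show "x \<otimes>\<^bsub>T\<^esub> j (1, \<one>) = j (1, \<one>) \<otimes>\<^bsub>T\<^esub> x" if "x \<in> carrier T" for x
    using that L.u_closed by (auto simp: transport_simps(1)) (auto simp: transport_simps lex_simps one_in add.commute)
  show "?s (x \<otimes>\<^bsub>T\<^esub> y) = ?s x + ?s y" if xy: "x \<in> carrier T" "y \<in> carrier T" for x y
  proof -
    obtain a b where "a \<in> carrier L" "x = j a" "b \<in> carrier L" "y = j b"
      using xy by (auto simp: transport_simps(1))
    then show ?thesis
      using inj by (cases a; cases b) (simp add: transport_simps lex_simps plus_in)
  qed
  show "0 \<le> ?s x" if x: "x \<in> carrier T" "grp_le T \<one>\<^bsub>T\<^esub> x" for x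
  proof -
    obtain a where "a \<in> carrier L" "x = j a" using x by (auto simp: transport_simps(1))
    then show ?thesis
      using inj x(2) L.one_closed by (cases a) (auto simp: transport_simps lex_simps)
  qed
  show "grp_le T \<one>\<^bsub>T\<^esub> x" if x: "x \<in> carrier T" "0 < ?s x" for x
  proof -
    obtain a where "a \<in> carrier L" "x = j a" using x by (auto simp: transport_simps(1))
    then show ?thesis
      using inj x(2) L.one_closed by (cases a) (auto simp: transport_simps lex_simps)
  qed
  show "?s (j (1, \<one>)) = 1" using inj L.u_closed by simp
qed

lemma weak_free_product_of_iso:
  assumes P: "in_symmetric_variety P" and f: "f \<in> pmv_iso N P"
  shows "weak_free_product TYPE('w) A1 A2 P (f \<circ> (emb1 \<circ> f1)) (f \<circ> (emb2 \<circ> f2))"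
proof -
  have P_closed: "pmv_closed P"
    using P by (auto simp: in_symmetric_variety_def in_class_M_def intro: pseudo_MV.pmv_closed)
  have f_hom': "f \<in> pmv_hom N P" and bij: "bij_betw f (carrier N) (carrier P)"
    using f by (auto simp: pmv_iso_def)
  let ?g = "inv_into (carrier N) f"
  have g: "?g \<in> pmv_iso P N" by (rule pmv_iso_inv[OF f N_closed])
  have gf: "?g (f x) = x" if "x \<in> carrier N" for x using bij that by (simp add: bij_betw_def)
  have emb_N1: "emb1 (f1 a) \<in> carrier N" if "a \<in> carrier A1" for a
    using that emb_hom(1) by (auto simp: pmv_hom_def)
  have emb_N2: "emb2 (f2 b) \<in> carrier N" if "b \<in> carrier A2" for b
    using that emb_hom(2) by (auto simp: pmv_hom_def)
  have gf1: "?g (f (emb1 (f1 a))) = emb1 (f1 a)" if "a \<in> carrier A1" for a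
    using gf emb_N1 that by blast
  have gf2: "?g (f (emb2 (f2 b))) = emb2 (f2 b)" if "b \<in> carrier A2" for b
    using gf emb_N2 that by blast
  let ?Y = "(f \<circ> (emb1 \<circ> f1)) ` carrier A1 \<union> (f \<circ> (emb2 \<circ> f2)) ` carrier A2"
  have Y: "?Y = f ` gens" by (simp add: gens_eq image_Un image_comp)
  have Y_sub: "?Y \<subseteq> carrier P" unfolding Y using gens_sub bij by (auto simp: bij_betw_def)
  have span: "pmv_span P ?Y = carrier P"
  proof
    show "pmv_span P ?Y \<subseteq> carrier P" by (rule pmv_span_subset[OF P_closed Y_sub])
    show "carrier P \<subseteq> pmv_span P ?Y"
    proof
      fix y assume "y \<in> carrier P"
      then have "y \<in> f ` carrier N" using bij by (simp add: bij_betw_def)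
      then obtain x where x: "x \<in> carrier N" "y = f x" by blast
      then show "y \<in> pmv_span P ?Y"
        unfolding Y using pmv_span_image[OF f_hom' N_closed gens_sub, of x] by (simp add: N_generated)
    qed
  qed
  have inj1: "inj_on (f \<circ> (emb1 \<circ> f1)) (carrier A1)"
    using f_bij(1) bij emb_N1 inj_emb1
    by (intro comp_inj_on) (auto simp: bij_betw_def intro: inj_on_subset)
  have inj2: "inj_on (f \<circ> (emb2 \<circ> f2)) (carrier A2)"
    using f_bij(2) bij emb_N2 inj_emb2
    by (intro comp_inj_on) (auto simp: bij_betw_def intro: inj_on_subset)
  \<comment> \<open>\<open>P\<close> is represented through \<open>N\<close> in the copied group
    \<open>T\<close>. There the embeddings commute because \<open>(h, \<one>)\<close> commutes with
    \<open>(of_int n, g)\<close>.\<close>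
  have rep: "unital_l_group T (j (1, \<one>)) \<and> j \<circ> ?g \<in> pmv_iso P (Gamma T (j (1, \<one>))) \<and>
      commuting_sums T (carrier A1) (carrier A2)
        ((j \<circ> ?g) \<circ> (f \<circ> (emb1 \<circ> f1))) ((j \<circ> ?g) \<circ> (f \<circ> (emb2 \<circ> f2)))"
    using T_unital pmv_iso_comp[OF g transport_iso] T_commuting
    by (simp add: commuting_sums_def gf1 gf2)
  have ex: "\<exists>!\<psi>. \<psi> \<in> pmv_hom P (Gamma W w) \<inter> extensional (carrier P) \<and>
      (\<forall>a\<in>carrier A1. \<psi> ((f \<circ> (emb1 \<circ> f1)) a) = \<kappa>\<^sub>1 a) \<and>
      (\<forall>b\<in>carrier A2. \<psi> ((f \<circ> (emb2 \<circ> f2)) b) = \<kappa>\<^sub>2 b)"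
    if W: "unital_l_group W w"
      and k: "\<kappa>\<^sub>1 \<in> pmv_hom A1 (Gamma W w)" "\<kappa>\<^sub>2 \<in> pmv_hom A2 (Gamma W w)"
      and comm: "commuting_sums W (carrier A1) (carrier A2) \<kappa>\<^sub>1 \<kappa>\<^sub>2"
    for W :: "'w ordered_group" and w \<kappa>\<^sub>1 \<kappa>\<^sub>2
  proof -
    obtain \<chi> where chi: "\<chi> \<in> pmv_hom N (Gamma W w)"
      "\<And>a. a \<in> carrier A1 \<Longrightarrow> \<chi> (emb1 (f1 a)) = \<kappa>\<^sub>1 a"
      "\<And>b. b \<in> carrier A2 \<Longrightarrow> \<chi> (emb2 (f2 b)) = \<kappa>\<^sub>2 b"
      using universal[OF W k comm] by blast
    let ?\<psi> = "restrict (\<chi> \<circ> ?g) (carrier P)"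
    have psi: "?\<psi> \<in> pmv_hom P (Gamma W w)"
      using g by (intro pmv_hom_restrict pmv_hom_comp[OF _ chi(1)] P_closed) (simp add: pmv_iso_def)
    show ?thesis
    proof (rule ex1I[of _ ?\<psi>])
      show "?\<psi> \<in> pmv_hom P (Gamma W w) \<inter> extensional (carrier P) \<and>
          (\<forall>a\<in>carrier A1. ?\<psi> ((f \<circ> (emb1 \<circ> f1)) a) = \<kappa>\<^sub>1 a) \<and>
          (\<forall>b\<in>carrier A2. ?\<psi> ((f \<circ> (emb2 \<circ> f2)) b) = \<kappa>\<^sub>2 b)"
        using psi Y_sub chi gf1 gf2 by auto
      fix \<psi>
      assume \<psi>: "\<psi> \<in> pmv_hom P (Gamma W w) \<inter> extensional (carrier P) \<and>
          (\<forall>a\<in>carrier A1. \<psi> ((f \<circ> (emb1 \<circ> f1)) a) = \<kappa>\<^sub>1 a) \<and>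
          (\<forall>b\<in>carrier A2. \<psi> ((f \<circ> (emb2 \<circ> f2)) b) = \<kappa>\<^sub>2 b)"
      have agree: "\<psi> y = ?\<psi> y" if "y \<in> ?Y" for y
        using that \<psi> Y_sub chi gf1 gf2 by auto
      have "\<psi> y = ?\<psi> y" if "y \<in> carrier P" for y
        using pmv_hom_eq_on_span[of \<psi> P _ ?\<psi>, OF _ psi P_closed Y_sub agree] \<psi> that span by blast
      then show "\<psi> = ?\<psi>" using \<psi> by (intro extensionalityI[of _ "carrier P"]) auto
    qed
  qed
  have hom: "f \<circ> (emb1 \<circ> f1) \<in> pmv_hom A1 P" "f \<circ> (emb2 \<circ> f2) \<in> pmv_hom A2 P"
    using pmv_hom_comp[OF _ f_hom'] emb_hom by blast+
  show ?thesis
    unfolding weak_free_product_def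
    using P hom inj1 inj2 rep span ex by blast
qed

text \<open>The usual uniqueness argument, with the two comparison maps drawn from different
  sources: \<open>P\<close> maps to the copy of \<open>N\<close> by its universal property, and
  \<open>N\<close> maps to a commuting representation of \<open>P\<close> by
  \<open>universal\<close>. They are mutually inverse on generators.\<close>

lemma iso_of_weak_free_product:
  assumes P: "weak_free_product TYPE('w) A1 A2 P \<phi>\<^sub>1 \<phi>\<^sub>2"
  shows "P \<cong>\<^sub>M N"
proof -
  have P_var: "in_symmetric_variety P"
    and phi: "\<phi>\<^sub>1 \<in> pmv_hom A1 P" "\<phi>\<^sub>2 \<in> pmv_hom A2 P"
    and span: "pmv_span P (\<phi>\<^sub>1 ` carrier A1 \<union> \<phi>\<^sub>2 ` carrier A2) = carrier P"
    using P by (simp_all add: weak_free_product_def)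
  have P_closed: "pmv_closed P"
    using P_var by (auto simp: in_symmetric_variety_def in_class_M_def intro: pseudo_MV.pmv_closed)
  obtain W :: "'w ordered_group" and w \<iota> where W: "unital_l_group W w"
    and \<iota>: "\<iota> \<in> pmv_iso P (Gamma W w)"
    and comm: "commuting_sums W (carrier A1) (carrier A2) (\<iota> \<circ> \<phi>\<^sub>1) (\<iota> \<circ> \<phi>\<^sub>2)"
    using P by (auto simp: weak_free_product_def)
  have \<iota>_hom: "\<iota> \<in> pmv_hom P (Gamma W w)" and \<iota>_inj: "inj_on \<iota> (carrier P)"
    using \<iota> by (auto simp: pmv_iso_def bij_betw_def)
  obtain \<chi> where chi: "\<chi> \<in> pmv_hom N (Gamma W w)"
      "\<And>a. a \<in> carrier A1 \<Longrightarrow> \<chi> (emb1 (f1 a)) = (\<iota> \<circ> \<phi>\<^sub>1) a"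
      "\<And>b. b \<in> carrier A2 \<Longrightarrow> \<chi> (emb2 (f2 b)) = (\<iota> \<circ> \<phi>\<^sub>2) b"
    using universal[OF W pmv_hom_comp[OF phi(1) \<iota>_hom] pmv_hom_comp[OF phi(2) \<iota>_hom] comm] by blast
  have "\<exists>!\<psi>. \<psi> \<in> pmv_hom P (Gamma T (j (1, \<one>))) \<inter> extensional (carrier P) \<and>
      (\<forall>a\<in>carrier A1. \<psi> (\<phi>\<^sub>1 a) = (j \<circ> (emb1 \<circ> f1)) a) \<and>
      (\<forall>b\<in>carrier A2. \<psi> (\<phi>\<^sub>2 b) = (j \<circ> (emb2 \<circ> f2)) b)"
    using P T_unital T_variety T_emb T_commuting unfolding weak_free_product_def by blast
  then obtain \<psi> where psi: "\<psi> \<in> pmv_hom P (Gamma T (j (1, \<one>)))"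
      "\<And>a. a \<in> carrier A1 \<Longrightarrow> \<psi> (\<phi>\<^sub>1 a) = j (emb1 (f1 a))"
      "\<And>b. b \<in> carrier A2 \<Longrightarrow> \<psi> (\<phi>\<^sub>2 b) = j (emb2 (f2 b))"
    by auto
  let ?\<iota>' = "inv_into (carrier P) \<iota>" and ?j' = "inv_into (carrier N) j"
  have \<iota>': "?\<iota>' \<in> pmv_hom (Gamma W w) P" and j': "?j' \<in> pmv_hom (Gamma T (j (1, \<one>))) N"
    using pmv_iso_inv[OF \<iota> P_closed] pmv_iso_inv[OF transport_iso N_closed]
    by (simp_all add: pmv_iso_def)
  have j'_j: "?j' (j x) = x" if "x \<in> carrier N" for x
    using that transport_iso by (simp add: pmv_iso_def bij_betw_def)
  have emb_N1: "emb1 (f1 a) \<in> carrier N" if "a \<in> carrier A1" for a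
    using that emb_hom(1) by (auto simp: pmv_hom_def)
  have emb_N2: "emb2 (f2 b) \<in> carrier N" if "b \<in> carrier A2" for b
    using that emb_hom(2) by (auto simp: pmv_hom_def)
  have j'_j1: "?j' (j (emb1 (f1 a))) = emb1 (f1 a)" if "a \<in> carrier A1" for a
    using j'_j emb_N1 that by blast
  have j'_j2: "?j' (j (emb2 (f2 b))) = emb2 (f2 b)" if "b \<in> carrier A2" for b
    using j'_j emb_N2 that by blast
  have phi_P1: "\<phi>\<^sub>1 a \<in> carrier P" if "a \<in> carrier A1" for a
    using that phi(1) by (auto simp: pmv_hom_def)
  have phi_P2: "\<phi>\<^sub>2 b \<in> carrier P" if "b \<in> carrier A2" for b
    using that phi(2) by (auto simp: pmv_hom_def)
  have "?j' \<circ> \<psi> \<in> pmv_iso P N"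
  proof (rule pmv_iso_of_inverse_on_generators)
    show "?j' \<circ> \<psi> \<in> pmv_hom P N" by (rule pmv_hom_comp[OF psi(1) j'])
    show "?\<iota>' \<circ> \<chi> \<in> pmv_hom N P" by (rule pmv_hom_comp[OF chi(1) \<iota>'])
    show "(?\<iota>' \<circ> \<chi>) ((?j' \<circ> \<psi>) x) = x" if "x \<in> \<phi>\<^sub>1 ` carrier A1 \<union> \<phi>\<^sub>2 ` carrier A2" for x
      using that psi chi j'_j1 j'_j2 phi_P1 phi_P2 \<iota>_inj by auto
    show "(?j' \<circ> \<psi>) ((?\<iota>' \<circ> \<chi>) y) = y" if "y \<in> gens" for y
      using that psi chi j'_j1 j'_j2 phi_P1 phi_P2 \<iota>_inj by (auto simp: gens_eq)
  qed (use P_closed span N_closed gens_sub N_generated phi_P1 phi_P2 in auto)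
  then show ?thesis unfolding pmv_isomorphic_def by blast
qed

end

text \<open>The intersection has a single member, the unique maximal ideal, which is normal by
  locality.\<close>

lemma Rad_n_local:
  assumes "pmv_local M"
  shows "pmv_normal_ideal M (Rad_n M)"
proof -
  obtain J where J: "pmv_maximal_ideal M J" "\<forall>K. pmv_maximal_ideal M K \<longrightarrow> K = J"
    using assms unfolding pmv_local_def by blast
  have normal: "pmv_normal_ideal M J" using J(1) assms by (simp add: pmv_local_def)
  have "J \<subseteq> carrier M"
    using J(1) by (simp add: pmv_maximal_ideal_def pmv_ideal_def)
  then have "Rad_n M = J" unfolding Rad_n_def using J normal by blast
  then show ?thesis using normal by simp
qed

theorem theorem6p1:
  fixes M :: "'m pmv" and G :: "'g ordered_group" and H :: "real set"
    and I :: "'m set" and N :: "(real \<times> 'g) pmv"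
  assumes "in_class_M M" and "pmv_symmetric M" and "pmv_local M"
    and "I = Rad_n M"
    and "subgroup H (additive_group (UNIV :: real set))" and "1 \<in> H"
    and "pmv_quotient M I \<cong>\<^sub>M Gamma (additive_group H) 1"
    and "l_group G"
    and "generated_subalgebra M I
           \<cong>\<^sub>M Gamma (additive_group (UNIV :: int set) \<times>\<^sub>l\<^sub>e\<^sub>x G) (1, \<one>\<^bsub>G\<^esub>)"
    and "N = Gamma (additive_group H \<times>\<^sub>l\<^sub>e\<^sub>x G) (1, \<one>\<^bsub>G\<^esub>)"
    \<comment> \<open>the universe \<open>'w\<close> over which the weak free product is tested is large enough\<close>
    and "infinite (UNIV :: 'w set)" and "\<exists>e :: 'm \<Rightarrow> 'w. inj_on e (carrier M)"
  shows "M \<cong>\<^sub>M N \<longleftrightarrow>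
    (\<exists>(P :: 'm pmv) \<phi>\<^sub>1 \<phi>\<^sub>2.
       weak_free_product TYPE('w) (pmv_quotient M I) (generated_subalgebra M I) P \<phi>\<^sub>1 \<phi>\<^sub>2 \<and>
       P \<cong>\<^sub>M M)"
proof -
  let ?A1 = "pmv_quotient M I" and ?A2 = "generated_subalgebra M I"
  interpret pseudo_MV M using assms(1) by (simp add: in_class_M_def)
  interpret normal_ideal M I
    using assms(2) Rad_n_local[OF assms(3)] assms(4) by unfold_locales (simp_all add: pmv_symmetric_def)
  have I_sub: "I \<subseteq> carrier M" using I_closed by blast
  obtain f1 where f1: "f1 \<in> pmv_iso ?A1 (Gamma (additive_group H) 1)"
    using assms(7) unfolding pmv_isomorphic_def by blast
  obtain f2 where f2: "f2 \<in> pmv_iso ?A2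
      (Gamma (additive_group (UNIV :: int set) \<times>\<^sub>l\<^sub>e\<^sub>x G) (1, \<one>\<^bsub>G\<^esub>))"
    using assms(9) unfolding pmv_isomorphic_def by blast
  interpret lex_model H G ?A1 ?A2 f1 f2
    using assms(5,6,8) f1 f2 pmv_closed_quotient pmv_closed_generated_subalgebra[OF pmv_closed I_sub]
    by (intro lex_model.intro lex_l_group.intro ordered_subgroup.intro lex_model_axioms.intro)
  obtain e :: "'m \<Rightarrow> 'w" where e: "inj_on e (carrier M)" using assms(12) by blast
  have "carrier ?A1 = pmv_class M I ` carrier M" by (simp add: pmv_quotient_def)
  \<comment> \<open>Choosing a representative in each class embeds the quotient into the carrier of
    \<open>M\<close>, and from there into \<open>'w\<close>.\<close>
  then have "inj_on (e \<circ> (inv_into (carrier M) (pmv_class M I) \<circ> inv_into (carrier ?A1) f1))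
      (carrier (Gamma (additive_group H) 1))"
    using f_bij(1) e
    by (intro comp_inj_on inj_on_inv_into)
       (auto simp: bij_betw_def inv_into_into intro!: inj_on_subset[OF e])
  moreover have "inj_on (e \<circ> inv_into (carrier ?A2) f2) (carrier (Gamma Z.L (1, \<one>\<^bsub>G\<^esub>)))"
  proof (intro comp_inj_on inj_on_inv_into)
    have "carrier ?A2 \<subseteq> carrier M"
      using pmv_span_subset[OF pmv_closed I_sub] by (simp add: generated_subalgebra_def)
    then show "inj_on e (inv_into (carrier ?A2) f2 ` carrier (Gamma Z.L (1, \<one>\<^bsub>G\<^esub>)))"
      using f_bij(2) by (intro inj_on_subset[OF e]) (auto simp: bij_betw_def inv_into_into)
  qed (use f_bij(2) in \<open>simp add: bij_betw_def\<close>)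
  ultimately obtain j :: "real \<times> 'g \<Rightarrow> 'w" where "inj_on j (carrier L)"
    using lex_carrier_embeds[OF lex_l_group_axioms assms(11)] by blast
  then interpret lex_model_in H G ?A1 ?A2 f1 f2 j
    by unfold_locales
  have M_var: "in_symmetric_variety M"
    using assms(1,2) by (simp add: in_symmetric_variety_def)
  show ?thesis
  proof
    assume "M \<cong>\<^sub>M N"
    then obtain f where "f \<in> pmv_iso N M"
      using pmv_isomorphic_sym[OF _ pmv_closed] unfolding pmv_isomorphic_def by blast
    \<comment> \<open>The witness is \<open>M\<close> itself, with the embeddings carried over from
      \<open>N\<close>.\<close>
    then show "\<exists>(P :: 'm pmv) \<phi>\<^sub>1 \<phi>\<^sub>2. weak_free_product TYPE('w) ?A1 ?A2 P \<phi>\<^sub>1 \<phi>\<^sub>2 \<and> P \<cong>\<^sub>M M"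
      using weak_free_product_of_iso[OF M_var] pmv_isomorphic_refl assms(10) by blast
  next
    assume "\<exists>(P :: 'm pmv) \<phi>\<^sub>1 \<phi>\<^sub>2. weak_free_product TYPE('w) ?A1 ?A2 P \<phi>\<^sub>1 \<phi>\<^sub>2 \<and> P \<cong>\<^sub>M M"
    then obtain P :: "'m pmv" and \<phi>\<^sub>1 \<phi>\<^sub>2
      where P: "weak_free_product TYPE('w) ?A1 ?A2 P \<phi>\<^sub>1 \<phi>\<^sub>2" "P \<cong>\<^sub>M M" by blast
    then have "pmv_closed P"
      by (auto simp: weak_free_product_def in_symmetric_variety_def in_class_M_def
          intro: pseudo_MV.pmv_closed)
    then have "M \<cong>\<^sub>M P" using P(2) by (rule pmv_isomorphic_sym[rotated])
    then show "M \<cong>\<^sub>M N"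
      using iso_of_weak_free_product[OF P(1)] pmv_isomorphic_trans assms(10) by blast
  qed
qed

end
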